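(* For every diffeological group $G$, the quotient map $\pi : EG \to BG$ is a $D$-numerable principal $G$-bundle.
   Context: A diffeological space is a set $X$ with a specified set of functions $U \to X$ (plots) for each open $U \subseteq \mathbb{R}^n$, $n \in \mathbb{N}$, such that constant functions are plots, precomposing a plot $U\to X$ with a smooth map $V \to U$ between open subsets of Euclidean spaces gives a plot, and a function $U\to X$ that is locally a plot is a plot. A map $f : X \to Y$ is smooth if $f\circ p$ is a plot of $Y$ for every plot $p$ of $X$; a diffeomorphism is an invertible smooth map with smooth inverse. $\mathbb{R}$ carries the standard diffeology (plots are the usual smooth maps). A function into a product is a plot iff its components are; subsets carry the sub-diffeology (plots of the ambient space landing in the subset); a quotient $X/{\sim}$ has the quotient diffeology (functions that locally lift to plots of $X$). A subset $A \subseteq X$ is $D$-open if $p^{-1}(A)$ is open for every plot $p$; these sets form the $D$-topology. A diffeological group is a diffeological space with a group structure whose operations are smooth. Let $G$ be a diffeological group, $\pi : E \to B$ a smooth map, and let $G$ act smoothly on $E$ from the right with $\pi(x\cdot g)=\pi(x)$. Then $\pi$ is a trivial principal $G$-bundle if there is a $G$-equivariant diffeomorphism $E \to B \times G$ over $B$ (with $(b,g)\cdot g' = (b,gg')$); locally trivial if $B$ has a $D$-open cover $\{B_i\}$ such that each $\pi^{-1}(B_i) \to B_i$ is trivial; and a principal $G$-bundle if its pullback along every plot of $B$ is a locally trivial principal $G$-bundle. A smooth partition of unity on $X$ is a family of smooth functions $\mu_i : X \to \mathbb{R}$, $i \in I$, with $\mu_i \geq 0$, with $\{\operatorname{supp}(\mu_i)\}$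 locally finite (each point has a $D$-open neighbourhood meeting only finitely many of them) and $\sum_i \mu_i = 1$, where $\operatorname{supp}(\mu_i)$ is the closure of $\mu_i^{-1}((0,\infty))$ in the $D$-topology. It is subordinate to a collection $\{X_i\}_{i\in I}$ if $\operatorname{supp}(\mu_i) \subseteq X_i$ for each $i$. A principal $G$-bundle $\pi : E \to B$ is $D$-numerable if there is a smooth partition of unity subordinate to a $D$-open cover $\{B_i\}$ of $B$ such that each $\pi^{-1}(B_i) \to B_i$ is a trivial principal $G$-bundle. Construction of $EG$ and $BG$: $\Delta^\omega = \{(t_0,t_1,\ldots) \in \oplus_\omega \mathbb{R} : \sum_i t_i = 1,\ t_i \geq 0 \text{ for all } i\}$, with the diffeology in which $t : U \to \Delta^\omega$ is a plot iff each component $t_i : U \to \mathbb{R}$ is smooth and each $u \in U$ has an open neighbourhood $V$ and an $n \in \mathbb{N}$ with $t_i|_V = 0$ for all $i > n$. $EG$ is the quotient diffeological space of $\Delta^\omega \times \prod_\omega G$ by the equivalence relation $(t_i,g_i) \sim (t_i',g_i')$ iff $t_i = t_i'$ for every $i$ and $g_i = g_i'$ whenever $t_i = t_i' \neq 0$. $G$ acts smoothly on $EG$ on the right by $[t_i,g_i]\cdot g = [t_i, g_i g]$, and $BG$ is the orbit space $EG/G$ with the quotient diffeology. *)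

theory Defs
  imports "HOL-Algebra.Group" "HOL-Analysis.Analysis"
begin

section \<open>Smooth maps between open subsets of Euclidean spaces\<close>

text \<open>
  The definition of a diffeology quantifies over all dimensions, so \<open>\<real>\<^sup>n\<close> is the library's
  \<^const>\<open>Euclidean_space\<close> \<open>n\<close>, whose points are the \<open>x :: nat \<Rightarrow> real\<close> with \<open>x i = 0\<close> for \<open>i \<ge> n\<close>.
  A function with domain \<open>U\<close> is a total function of which only the values on \<open>U\<close> matter.
\<close>

definition partial_deriv :: "nat \<Rightarrow> ((nat \<Rightarrow> real) \<Rightarrow> real) \<Rightarrow> (nat \<Rightarrow> real) \<Rightarrow> real" where
  "partial_deriv i f x = deriv (\<lambda>t. f (x(i := t))) (x i)"

primrec C_k :: "nat \<Rightarrow> (nat \<Rightarrow> real) set \<Rightarrow> nat \<Rightarrow> ((nat \<Rightarrow> real) \<Rightarrow> real) \<Rightarrow> bool" where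
  "C_k n U 0 f \<longleftrightarrow> continuous_map (subtopology (Euclidean_space n) U) euclideanreal f"
| "C_k n U (Suc k) f \<longleftrightarrow>
     continuous_map (subtopology (Euclidean_space n) U) euclideanreal f \<and>
     (\<forall>i<n. (\<forall>x\<in>U. (\<lambda>t. f (x(i := t))) field_differentiable at (x i)) \<and>
            C_k n U k (partial_deriv i f))"

definition smooth_fun :: "nat \<Rightarrow> (nat \<Rightarrow> real) set \<Rightarrow> ((nat \<Rightarrow> real) \<Rightarrow> real) \<Rightarrow> bool" where
  "smooth_fun n U f \<longleftrightarrow> openin (Euclidean_space n) U \<and> (\<forall>k. C_k n U k f)"

definition smooth_map ::
    "nat \<Rightarrow> (nat \<Rightarrow> real) set \<Rightarrow> nat \<Rightarrow> (nat \<Rightarrow> real) set \<Rightarrow> ((nat \<Rightarrow> real) \<Rightarrow> nat \<Rightarrow> real) \<Rightarrow> bool" where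
  "smooth_map m V n U h \<longleftrightarrow>
     openin (Euclidean_space m) V \<and> openin (Euclidean_space n) U \<and> h \<in> V \<rightarrow> U \<and>
     (\<forall>i<n. smooth_fun m V (\<lambda>x. h x i))"


section \<open>Diffeological spaces\<close>

text \<open>\<open>plot X n U p\<close> says that \<open>p\<close> restricted to \<open>U \<subseteq> \<real>\<^sup>n\<close> is a plot of \<open>X\<close>.\<close>

record 'a diffeology =
  pts :: "'a set"
  plot :: "nat \<Rightarrow> (nat \<Rightarrow> real) set \<Rightarrow> ((nat \<Rightarrow> real) \<Rightarrow> 'a) \<Rightarrow> bool"

text \<open>The second condition expresses that being a plot depends only on \<open>p\<close> restricted to \<open>U\<close>.\<close>

definition diffeological_space :: "'a diffeology \<Rightarrow> bool" where
  "diffeological_space X \<longleftrightarrow>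
     (\<forall>n U p. plot X n U p \<longrightarrow> openin (Euclidean_space n) U \<and> p \<in> U \<rightarrow> pts X) \<and>
     (\<forall>n U p q. plot X n U p \<and> (\<forall>u\<in>U. q u = p u) \<longrightarrow> plot X n U q) \<and>
     (\<forall>n U x. openin (Euclidean_space n) U \<and> x \<in> pts X \<longrightarrow> plot X n U (\<lambda>_. x)) \<and>
     (\<forall>m V n U h p. plot X n U p \<and> smooth_map m V n U h \<longrightarrow> plot X m V (p \<circ> h)) \<and>
     (\<forall>n U p. openin (Euclidean_space n) U \<and>
        (\<forall>u\<in>U. \<exists>V. openin (Euclidean_space n) V \<and> u \<in> V \<and> V \<subseteq> U \<and> plot X n V p) \<longrightarrow>
        plot X n U p)"

definition dsmooth :: "'a diffeology \<Rightarrow> 'b diffeology \<Rightarrow> ('a \<Rightarrow> 'b) \<Rightarrow> bool" where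
  "dsmooth X Y f \<longleftrightarrow>
     f \<in> pts X \<rightarrow> pts Y \<and> (\<forall>n U p. plot X n U p \<longrightarrow> plot Y n U (f \<circ> p))"

definition diffeomorphism :: "'a diffeology \<Rightarrow> 'b diffeology \<Rightarrow> ('a \<Rightarrow> 'b) \<Rightarrow> bool" where
  "diffeomorphism X Y f \<longleftrightarrow>
     dsmooth X Y f \<and>
     (\<exists>g. dsmooth Y X g \<and> (\<forall>x\<in>pts X. g (f x) = x) \<and> (\<forall>y\<in>pts Y. f (g y) = y))"

definition real_diff :: "real diffeology" where
  "real_diff = \<lparr>pts = UNIV, plot = smooth_fun\<rparr>"

definition euclid_diff :: "nat \<Rightarrow> (nat \<Rightarrow> real) set \<Rightarrow> (nat \<Rightarrow> real) diffeology" where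
  "euclid_diff n U = \<lparr>pts = U, plot = (\<lambda>m V h. smooth_map m V n U h)\<rparr>"

definition prod_diff :: "'a diffeology \<Rightarrow> 'b diffeology \<Rightarrow> ('a \<times> 'b) diffeology" where
  "prod_diff X Y =
     \<lparr>pts = pts X \<times> pts Y,
      plot = (\<lambda>n U p. plot X n U (fst \<circ> p) \<and> plot Y n U (snd \<circ> p))\<rparr>"

definition seq_diff :: "'a diffeology \<Rightarrow> (nat \<Rightarrow> 'a) diffeology" where
  "seq_diff X =
     \<lparr>pts = {g. \<forall>i. g i \<in> pts X},
      plot = (\<lambda>n U p. \<forall>i. plot X n U (\<lambda>u. p u i))\<rparr>"

definition sub_diff :: "'a diffeology \<Rightarrow> 'a set \<Rightarrow> 'a diffeology" where
  "sub_diff X A =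
     \<lparr>pts = pts X \<inter> A, plot = (\<lambda>n U p. plot X n U p \<and> p \<in> U \<rightarrow> A)\<rparr>"

definition quot_diff :: "'a diffeology \<Rightarrow> ('a \<times> 'a) set \<Rightarrow> 'a set diffeology" where
  "quot_diff X R =
     \<lparr>pts = pts X // R,
      plot = (\<lambda>n U p. openin (Euclidean_space n) U \<and>
        (\<forall>u\<in>U. \<exists>V q. openin (Euclidean_space n) V \<and> u \<in> V \<and> V \<subseteq> U \<and>
           plot X n V q \<and> (\<forall>v\<in>V. p v = R `` {q v})))\<rparr>"

definition D_open :: "'a diffeology \<Rightarrow> 'a set \<Rightarrow> bool" where
  "D_open X A \<longleftrightarrow>
     A \<subseteq> pts X \<and> (\<forall>n U p. plot X n U p \<longrightarrow> openin (Euclidean_space n) {u \<in> U. p u \<in> A})"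

definition D_topology :: "'a diffeology \<Rightarrow> 'a topology" where
  "D_topology X = topology (D_open X)"

lemma openin_D_topology: "openin (D_topology X) = D_open X"
proof -
  have "istopology (D_open X)"
    unfolding istopology_def
  proof (intro conjI allI impI)
    fix S T assume S: "D_open X S" and T: "D_open X T"
    have "openin (Euclidean_space n) {u \<in> U. p u \<in> S \<inter> T}" if "plot X n U p" for n U p
    proof -
      have "{u \<in> U. p u \<in> S \<inter> T} = {u \<in> U. p u \<in> S} \<inter> {u \<in> U. p u \<in> T}" by auto
      with S T that show ?thesis by (simp add: D_open_def openin_Int)
    qed
    with S show "D_open X (S \<inter> T)" by (auto simp: D_open_def)
  next
    fix \<K> assume K: "\<forall>K\<in>\<K>. D_open X K"
    have "openin (Euclidean_space n) {u \<in> U. p u \<in> \<Union>\<K>}" if "plot X n U p" for n U p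
    proof -
      have "{u \<in> U. p u \<in> \<Union>\<K>} = (\<Union>K\<in>\<K>. {u \<in> U. p u \<in> K})" by auto
      with K that show ?thesis by (auto simp: D_open_def)
    qed
    with K show "D_open X (\<Union>\<K>)" by (auto simp: D_open_def)
  qed
  then show ?thesis by (simp add: D_topology_def)
qed


section \<open>Diffeological groups and principal bundles\<close>

definition diffeological_group :: "('g, 'm) monoid_scheme \<Rightarrow> 'g diffeology \<Rightarrow> bool" where
  "diffeological_group G D \<longleftrightarrow>
     group G \<and> diffeological_space D \<and> pts D = carrier G \<and>
     dsmooth (prod_diff D D) D (\<lambda>(x, y). x \<otimes>\<^bsub>G\<^esub> y) \<and>
     dsmooth D D (m_inv G)"

definition smooth_right_action ::
    "('g, 'm) monoid_scheme \<Rightarrow> 'g diffeology \<Rightarrow> 'e diffeology \<Rightarrow> ('e \<Rightarrow> 'g \<Rightarrow> 'e) \<Rightarrow> bool" where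
  "smooth_right_action G D E act \<longleftrightarrow>
     dsmooth (prod_diff E D) E (\<lambda>(x, g). act x g) \<and>
     (\<forall>x\<in>pts E. act x \<one>\<^bsub>G\<^esub> = x) \<and>
     (\<forall>x\<in>pts E. \<forall>g\<in>carrier G. \<forall>h\<in>carrier G. act (act x g) h = act x (g \<otimes>\<^bsub>G\<^esub> h))"

text \<open>The standing assumptions under which the bundle conditions below are imposed on \<open>\<pi> : E \<rightarrow> B\<close>.\<close>

definition bundle_data ::
    "('g, 'm) monoid_scheme \<Rightarrow> 'g diffeology \<Rightarrow> 'e diffeology \<Rightarrow> 'b diffeology \<Rightarrow>
     ('e \<Rightarrow> 'g \<Rightarrow> 'e) \<Rightarrow> ('e \<Rightarrow> 'b) \<Rightarrow> bool" where
  "bundle_data G D E B act \<pi> \<longleftrightarrow>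
     diffeological_group G D \<and> diffeological_space E \<and> diffeological_space B \<and>
     dsmooth E B \<pi> \<and> smooth_right_action G D E act \<and>
     (\<forall>x\<in>pts E. \<forall>g\<in>carrier G. \<pi> (act x g) = \<pi> x)"

definition trivial_principal_bundle ::
    "('g, 'm) monoid_scheme \<Rightarrow> 'g diffeology \<Rightarrow> 'e diffeology \<Rightarrow> 'b diffeology \<Rightarrow>
     ('e \<Rightarrow> 'g \<Rightarrow> 'e) \<Rightarrow> ('e \<Rightarrow> 'b) \<Rightarrow> bool" where
  "trivial_principal_bundle G D E B act \<pi> \<longleftrightarrow>
     bundle_data G D E B act \<pi> \<and>
     (\<exists>\<phi>. diffeomorphism E (prod_diff B D) \<phi> \<and>
        (\<forall>x\<in>pts E. fst (\<phi> x) = \<pi> x) \<and>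
        (\<forall>x\<in>pts E. \<forall>g\<in>carrier G. \<phi> (act x g) = (fst (\<phi> x), snd (\<phi> x) \<otimes>\<^bsub>G\<^esub> g)))"

definition trivial_over ::
    "('g, 'm) monoid_scheme \<Rightarrow> 'g diffeology \<Rightarrow> 'e diffeology \<Rightarrow> 'b diffeology \<Rightarrow>
     ('e \<Rightarrow> 'g \<Rightarrow> 'e) \<Rightarrow> ('e \<Rightarrow> 'b) \<Rightarrow> 'b set \<Rightarrow> bool" where
  "trivial_over G D E B act \<pi> A \<longleftrightarrow>
     trivial_principal_bundle G D (sub_diff E {x \<in> pts E. \<pi> x \<in> A}) (sub_diff B A) act \<pi>"

definition locally_trivial_principal_bundle ::
    "('g, 'm) monoid_scheme \<Rightarrow> 'g diffeology \<Rightarrow> 'e diffeology \<Rightarrow> 'b diffeology \<Rightarrow>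
     ('e \<Rightarrow> 'g \<Rightarrow> 'e) \<Rightarrow> ('e \<Rightarrow> 'b) \<Rightarrow> bool" where
  "locally_trivial_principal_bundle G D E B act \<pi> \<longleftrightarrow>
     bundle_data G D E B act \<pi> \<and>
     (\<exists>\<U>. (\<forall>A\<in>\<U>. D_open B A) \<and> \<Union>\<U> = pts B \<and> (\<forall>A\<in>\<U>. trivial_over G D E B act \<pi> A))"

definition pullback_diff ::
    "'c diffeology \<Rightarrow> 'e diffeology \<Rightarrow> ('c \<Rightarrow> 'b) \<Rightarrow> ('e \<Rightarrow> 'b) \<Rightarrow> ('c \<times> 'e) diffeology" where
  "pullback_diff C E f \<pi> =
     sub_diff (prod_diff C E) {(c, x). c \<in> pts C \<and> x \<in> pts E \<and> f c = \<pi> x}"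

definition principal_bundle ::
    "('g, 'm) monoid_scheme \<Rightarrow> 'g diffeology \<Rightarrow> 'e diffeology \<Rightarrow> 'b diffeology \<Rightarrow>
     ('e \<Rightarrow> 'g \<Rightarrow> 'e) \<Rightarrow> ('e \<Rightarrow> 'b) \<Rightarrow> bool" where
  "principal_bundle G D E B act \<pi> \<longleftrightarrow>
     bundle_data G D E B act \<pi> \<and>
     (\<forall>n U p. plot B n U p \<longrightarrow>
        locally_trivial_principal_bundle G D
          (pullback_diff (euclid_diff n U) E p \<pi>) (euclid_diff n U)
          (\<lambda>(u, x) g. (u, act x g)) fst)"


section \<open>Smooth partitions of unity and D-numerable bundles\<close>

definition D_supp :: "'a diffeology \<Rightarrow> ('a \<Rightarrow> real) \<Rightarrow> 'a set" where
  "D_supp X \<mu> = D_topology X closure_of {x \<in> pts X. \<mu> x > 0}"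

text \<open>Here \<^const>\<open>supp_sum\<close> sums over the indices with nonzero value, finitely many at each point
  by local finiteness.\<close>

definition smooth_partition_of_unity ::
    "'a diffeology \<Rightarrow> 'i set \<Rightarrow> ('i \<Rightarrow> 'a \<Rightarrow> real) \<Rightarrow> bool" where
  "smooth_partition_of_unity X I \<mu> \<longleftrightarrow>
     (\<forall>i\<in>I. dsmooth X real_diff (\<mu> i)) \<and>
     (\<forall>i\<in>I. \<forall>x\<in>pts X. \<mu> i x \<ge> 0) \<and>
     (\<forall>x\<in>pts X. \<exists>W. D_open X W \<and> x \<in> W \<and> finite {i \<in> I. D_supp X (\<mu> i) \<inter> W \<noteq> {}}) \<and>
     (\<forall>x\<in>pts X. supp_sum (\<lambda>i. \<mu> i x) I = 1)"

definition subordinate ::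
    "'a diffeology \<Rightarrow> 'i set \<Rightarrow> ('i \<Rightarrow> 'a \<Rightarrow> real) \<Rightarrow> ('i \<Rightarrow> 'a set) \<Rightarrow> bool" where
  "subordinate X I \<mu> A \<longleftrightarrow> (\<forall>i\<in>I. D_supp X (\<mu> i) \<subseteq> A i)"

text \<open>
  A definition cannot quantify over the type of the index set, so indices are taken from
  \<^typ>\<open>'b set\<close>. This loses no generality: if a cover repeats a set, the (locally finite) sum of the
  functions belonging to that set can replace them, so a cover can be indexed by its members.
\<close>

definition D_numerable_principal_bundle ::
    "('g, 'm) monoid_scheme \<Rightarrow> 'g diffeology \<Rightarrow> 'e diffeology \<Rightarrow> 'b diffeology \<Rightarrow>
     ('e \<Rightarrow> 'g \<Rightarrow> 'e) \<Rightarrow> ('e \<Rightarrow> 'b) \<Rightarrow> bool" where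
  "D_numerable_principal_bundle G D E B act \<pi> \<longleftrightarrow>
     principal_bundle G D E B act \<pi> \<and>
     (\<exists>(I :: 'b set set) A \<mu>.
        (\<forall>i\<in>I. D_open B (A i)) \<and> (\<Union>i\<in>I. A i) = pts B \<and>
        (\<forall>i\<in>I. trivial_over G D E B act \<pi> (A i)) \<and>
        smooth_partition_of_unity B I \<mu> \<and> subordinate B I \<mu> A)"


section \<open>The bundle \<open>EG \<rightarrow> BG\<close>\<close>

definition simplex_diff :: "(nat \<Rightarrow> real) diffeology" where
  "simplex_diff =
     (let S = {t. finite {i. t i \<noteq> 0} \<and> (\<Sum>i | t i \<noteq> 0. t i) = 1 \<and> (\<forall>i. t i \<ge> 0)} in
     \<lparr>pts = S,
      plot = (\<lambda>n U t. openin (Euclidean_space n) U \<and> t \<in> U \<rightarrow> S \<and>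
        (\<forall>i. smooth_fun n U (\<lambda>u. t u i)) \<and>
        (\<forall>u\<in>U. \<exists>V N. openin (Euclidean_space n) V \<and> u \<in> V \<and> V \<subseteq> U \<and>
           (\<forall>v\<in>V. \<forall>i>N. t v i = 0)))\<rparr>)"

definition EG_pre :: "'g diffeology \<Rightarrow> ((nat \<Rightarrow> real) \<times> (nat \<Rightarrow> 'g)) diffeology" where
  "EG_pre D = prod_diff simplex_diff (seq_diff D)"

definition EG_rel ::
    "'g diffeology \<Rightarrow> (((nat \<Rightarrow> real) \<times> (nat \<Rightarrow> 'g)) \<times> ((nat \<Rightarrow> real) \<times> (nat \<Rightarrow> 'g))) set" where
  "EG_rel D =
     {((t, g), (t', g')). (t, g) \<in> pts (EG_pre D) \<and> (t', g') \<in> pts (EG_pre D) \<and>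
        (\<forall>i. t i = t' i) \<and> (\<forall>i. t i = t' i \<and> t' i \<noteq> 0 \<longrightarrow> g i = g' i)}"

type_synonym 'g EG_point = "((nat \<Rightarrow> real) \<times> (nat \<Rightarrow> 'g)) set"

definition EG :: "'g diffeology \<Rightarrow> 'g EG_point diffeology" where
  "EG D = quot_diff (EG_pre D) (EG_rel D)"

definition EG_act ::
    "('g, 'm) monoid_scheme \<Rightarrow> 'g diffeology \<Rightarrow> 'g EG_point \<Rightarrow> 'g \<Rightarrow> 'g EG_point" where
  "EG_act G D c h = (\<Union>(t, g)\<in>c. EG_rel D `` {(t, \<lambda>i. g i \<otimes>\<^bsub>G\<^esub> h)})"

definition orbit_rel ::
    "('g, 'm) monoid_scheme \<Rightarrow> 'e diffeology \<Rightarrow> ('e \<Rightarrow> 'g \<Rightarrow> 'e) \<Rightarrow> ('e \<times> 'e) set" where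
  "orbit_rel G E act = {(x, y). x \<in> pts E \<and> (\<exists>g\<in>carrier G. y = act x g)}"

definition BG :: "('g, 'm) monoid_scheme \<Rightarrow> 'g diffeology \<Rightarrow> 'g EG_point set diffeology" where
  "BG G D = quot_diff (EG D) (orbit_rel G (EG D) (EG_act G D))"

definition EG_proj ::
    "('g, 'm) monoid_scheme \<Rightarrow> 'g diffeology \<Rightarrow> 'g EG_point \<Rightarrow> 'g EG_point set" where
  "EG_proj G D x = orbit_rel G (EG D) (EG_act G D) `` {x}"

end

theory Submission
  imports Defs
begin

text \<open>
  A point of \<open>EG\<close> is a finite formal convex combination of group elements, with barycentric coordinates
  \<open>t\<^sub>n\<close> and group coordinates \<open>g\<^sub>n\<close>, the latter defined where \<open>t\<^sub>n \<noteq> 0\<close>. The action leaves \<open>t\<close>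
  unchanged, so \<open>t\<close> descends to a smooth map \<open>BG \<rightarrow> \<Delta>\<^sup>\<omega>\<close>, and the sets \<open>A\<^sub>n = {t\<^sub>n \<noteq> 0}\<close> form a
  D-open cover of \<open>BG\<close>.

  Over \<open>A\<^sub>n\<close> the coordinate \<open>g\<^sub>n\<close> is a smooth equivariant map to \<open>G\<close>. Such a map \<open>\<tau>\<close> trivialises any
  bundle whose fibres are the orbits and whose base plots lift locally: the trivialisation is
  \<open>x \<mapsto> (\<pi> x, \<tau> x)\<close> (\<open>trivial_principal_bundle_if_equivariant\<close>). Both conditions hold for the
  projection onto an orbit space (\<open>orbit_bundle_orbit_space\<close>) and survive restriction and pullback, so
  the bundle is principal (\<open>orbit_bundle_principal\<close>).

  The coordinates \<open>t\<^sub>n\<close> sum to one, but they are locally finite only along each plot, not in the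
  D-topology, and the support of \<open>t\<^sub>n\<close> is not contained in \<open>A\<^sub>n\<close>. Both defects are cured by a
  threshold. Let \<open>Q = \<Sum>\<^sub>k t\<^sub>k\<^sup>2\<close>, a positive smooth function on the simplex, let \<open>\<phi>\<close> be smooth on the real
  line, positive on \<open>(0, \<infinity>)\<close> and zero elsewhere, and put \<open>w\<^sub>n = \<phi> (2 t\<^sub>n - Q)\<close>. The
  support of \<open>w\<^sub>n\<close> lies in the D-closed set \<open>{2 t\<^sub>n \<ge> Q}\<close>, hence in \<open>A\<^sub>n\<close>. At each point some \<open>w\<^sub>n\<close> is
  positive, as otherwise \<open>Q = \<Sum>\<^sub>k t\<^sub>k\<^sup>2 \<le> \<Sum>\<^sub>k t\<^sub>k Q / 2 = Q / 2\<close>. Finally, for a point whose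
  coordinates beyond \<open>N\<close> vanish, the inequality \<open>\<Sum>\<^sub>k\<^sub>>\<^sub>N t\<^sub>k < Q / 2\<close> defines a D-open
  neighbourhood that meets none of the supports with \<open>n > N\<close>
  (\<open>simplex_partition_locally_finite\<close>). Dividing by \<open>\<Sum>\<^sub>k w\<^sub>k\<close> gives the partition of unity.

  The rest is calculus on open subsets of \<open>\<real>\<^sup>n\<close>: smooth functions are closed under arithmetic
  and composition, where the latter rests on the chain rule for functions with continuous partial
  derivatives (\<open>C_1_chain_rule\<close>), and \<open>\<phi> x = exp (- 1 / x)\<close> for \<open>x > 0\<close> is smooth at \<open>0\<close>.
\<close>

section \<open>Calculus of \<open>C\<^sup>k\<close> functions\<close>

text \<open>
  Open subsets of \<open>Euclidean_space n\<close> lie in a subspace of the product topology, which is the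
  type class topology of \<open>nat \<Rightarrow> real\<close>. Continuity in the abstract sense therefore becomes
  \<open>continuous_on\<close>, for which the closure properties under arithmetic are available.
\<close>
lemma continuous_map_Euclidean_open_iff:
  assumes "openin (Euclidean_space n) U"
  shows "continuous_map (subtopology (Euclidean_space n) U) euclideanreal f \<longleftrightarrow> continuous_on U f"
proof -
  have "U \<subseteq> {x. \<forall>i\<ge>n. x i = 0}"
    using openin_subset[OF assms] by (simp add: topspace_Euclidean_space)
  then have "{x. \<forall>i\<ge>n. x i = 0} \<inter> U = U" by blast
  then show ?thesis
    by (simp add: Euclidean_space_def subtopology_subtopology euclidean_product_topology)
qed

lemma openin_Euclidean_box:
  assumes "openin (Euclidean_space n) U" "x \<in> U"
  obtains e where "e > 0" "\<And>y. (\<And>i. i < n \<Longrightarrow> \<bar>y i - x i\<bar> < e) \<Longrightarrow> (\<And>i. i \<ge> n \<Longrightarrow> y i = 0) \<Longrightarrow> y \<in> U"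
proof -
  from assms(1) obtain T where T: "openin (powertop_real UNIV) T" "U = T \<inter> {x. \<forall>i\<ge>n. x i = 0}"
    by (auto simp: Euclidean_space_def openin_subtopology)
  with assms(2) have "x \<in> T" by blast
  with T(1) obtain X where X: "\<And>i. open (X i)" "x \<in> Pi\<^sub>E UNIV X" "Pi\<^sub>E UNIV X \<subseteq> T"
    unfolding openin_product_topology_alt by fastforce
  have "\<exists>e>0. \<forall>y. \<bar>y - x i\<bar> < e \<longrightarrow> y \<in> X i" for i
    using X(1)[of i] X(2) unfolding open_dist by (auto simp: dist_real_def)
  then obtain e where e: "\<And>i. e i > 0" "\<And>i y. \<bar>y - x i\<bar> < e i \<Longrightarrow> y \<in> X i" by metis
  define d where "d = Min (insert 1 (e ` {..<n}))"
  have "d > 0" using e(1) by (simp add: d_def)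
  have de: "d \<le> e i" if "i < n" for i
    unfolding d_def using that by (intro Min_le) auto
  have x0: "x i = 0" if "i \<ge> n" for i using assms(2) T(2) that by auto
  show thesis
  proof (rule that[OF \<open>d > 0\<close>])
    fix y assume y: "\<And>i. i < n \<Longrightarrow> \<bar>y i - x i\<bar> < d" "\<And>i. i \<ge> n \<Longrightarrow> y i = 0"
    have "y i \<in> X i" for i
      using y(1)[of i] de[of i] y(2)[of i] x0[of i] e(1)[of i]
      by (cases "i < n") (auto intro!: e(2))
    then have "y \<in> T" using X(3) by (auto simp: PiE_def Pi_def)
    with y(2) T(2) show "y \<in> U" by auto
  qed
qed

lemma eventually_coordinate_line:
  assumes "openin (Euclidean_space n) U" "x \<in> U" "i < n"
  shows "\<forall>\<^sub>F t in nhds (x i). x(i := t) \<in> U"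
proof -
  obtain e where e: "e > 0" "\<And>y. (\<And>i. i < n \<Longrightarrow> \<bar>y i - x i\<bar> < e) \<Longrightarrow> (\<And>i. i \<ge> n \<Longrightarrow> y i = 0) \<Longrightarrow> y \<in> U"
    using openin_Euclidean_box[OF assms(1,2)] by blast
  have x0: "x j = 0" if "j \<ge> n" for j
    using openin_subset[OF assms(1)] assms(2) that by (auto simp: topspace_Euclidean_space)
  show ?thesis
    unfolding eventually_nhds_metric
  proof (intro exI conjI allI impI)
    show "e > 0" by fact
    fix t assume "dist t (x i) < e"
    then show "x(i := t) \<in> U" using assms(3) x0 e(1) by (intro e(2)) (auto simp: dist_real_def)
  qed
qed

lemma partial_deriv_eqI:
  "((\<lambda>t. f (x(i := t))) has_real_derivative d) (at (x i)) \<Longrightarrow> partial_deriv i f x = d"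
  by (simp add: partial_deriv_def DERIV_imp_deriv)

lemma partial_deriv_works:
  "(\<lambda>t. f (x(i := t))) field_differentiable at (x i) \<Longrightarrow>
    ((\<lambda>t. f (x(i := t))) has_real_derivative partial_deriv i f x) (at (x i))"
  by (simp add: partial_deriv_def DERIV_deriv_iff_field_differentiable)

lemma has_partial_deriv_transform:
  assumes "openin (Euclidean_space n) U" "x \<in> U" "i < n" "\<And>y. y \<in> U \<Longrightarrow> f y = g y"
    and "((\<lambda>t. g (x(i := t))) has_real_derivative d) (at (x i))"
  shows "((\<lambda>t. f (x(i := t))) has_real_derivative d) (at (x i))"
proof -
  have "\<forall>\<^sub>F t in nhds (x i). f (x(i := t)) = g (x(i := t))"
    using eventually_coordinate_line[OF assms(1-3)] by eventually_elim (rule assms(4))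
  then show ?thesis using assms(5) by (subst DERIV_cong_ev) auto
qed

text \<open>
  The derivative is supplied as a formula \<open>f'\<close>, valid on \<open>U\<close> only, whereas the recursion speaks about
  the globally defined \<open>partial_deriv i f\<close>. The last premise hence asks for every function that
  agrees with \<open>f' i\<close> on \<open>U\<close>.
\<close>
lemma C_k_SucI:
  assumes "openin (Euclidean_space n) U" "continuous_on U f"
    and "\<And>i x. i < n \<Longrightarrow> x \<in> U \<Longrightarrow> ((\<lambda>t. f (x(i := t))) has_real_derivative f' i x) (at (x i))"
    and "\<And>i g. i < n \<Longrightarrow> (\<And>x. x \<in> U \<Longrightarrow> g x = f' i x) \<Longrightarrow> C_k n U k g"
  shows "C_k n U (Suc k) f"
proof -
  have "partial_deriv i f x = f' i x" if "i < n" "x \<in> U" for i x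
    using assms(3)[OF that] by (rule partial_deriv_eqI)
  then have "C_k n U k (partial_deriv i f)" if "i < n" for i
    using assms(4) that by blast
  moreover have "(\<lambda>t. f (x(i := t))) field_differentiable at (x i)" if "i < n" "x \<in> U" for i x
    using assms(3)[OF that] unfolding field_differentiable_def by blast
  ultimately show ?thesis
    using assms(2) by (simp add: continuous_map_Euclidean_open_iff[OF assms(1)])
qed

lemma C_k_imp_continuous_on:
  "openin (Euclidean_space n) U \<Longrightarrow> C_k n U k f \<Longrightarrow> continuous_on U f"
  by (cases k) (auto simp: continuous_map_Euclidean_open_iff)

lemma C_k_Suc_has_partial:
  "C_k n U (Suc k) f \<Longrightarrow> i < n \<Longrightarrow> x \<in> U \<Longrightarrow>
    ((\<lambda>t. f (x(i := t))) has_real_derivative partial_deriv i f x) (at (x i))"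
  by (intro partial_deriv_works) auto

lemma C_k_Suc_partial: "C_k n U (Suc k) f \<Longrightarrow> i < n \<Longrightarrow> C_k n U k (partial_deriv i f)"
  by simp

declare C_k.simps(2) [simp del]

lemma C_k_cong:
  assumes U: "openin (Euclidean_space n) U"
  shows "C_k n U k f \<Longrightarrow> (\<And>x. x \<in> U \<Longrightarrow> g x = f x) \<Longrightarrow> C_k n U k g"
proof (induction k arbitrary: f g)
  case 0
  then show ?case using continuous_on_cong[of U U g f]
    by (simp add: continuous_map_Euclidean_open_iff[OF U])
next
  case (Suc k)
  show ?case
  proof (rule C_k_SucI[OF U, where f' = "\<lambda>i. partial_deriv i f"])
    show "continuous_on U g"
      using C_k_imp_continuous_on[OF U Suc.prems(1)] Suc.prems(2) continuous_on_cong by blast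
    show "((\<lambda>t. g (x(i := t))) has_real_derivative partial_deriv i f x) (at (x i))"
      if "i < n" "x \<in> U" for i x
      by (rule has_partial_deriv_transform[OF U that(2,1) Suc.prems(2) C_k_Suc_has_partial[OF Suc.prems(1) that]])
    show "C_k n U k g'" if "i < n" "\<And>x. x \<in> U \<Longrightarrow> g' x = partial_deriv i f x" for i g'
      using Suc.IH C_k_Suc_partial[OF Suc.prems(1) that(1)] that(2) by blast
  qed
qed

lemma C_k_lower: "C_k n U (Suc k) f \<Longrightarrow> C_k n U k f"
  by (induction k arbitrary: f) (auto simp: C_k.simps)

lemma C_k_const:
  assumes U: "openin (Euclidean_space n) U"
  shows "C_k n U k (\<lambda>_. c)"
proof (induction k arbitrary: c)
  case (Suc k)
  show ?case
    by (rule C_k_SucI[OF U, where f' = "\<lambda>_ _. 0"]) (auto intro: C_k_cong[OF U Suc])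
qed (simp add: continuous_map_Euclidean_open_iff[OF U])

lemma C_k_add:
  assumes U: "openin (Euclidean_space n) U"
  shows "C_k n U k f \<Longrightarrow> C_k n U k g \<Longrightarrow> C_k n U k (\<lambda>x. f x + g x)"
proof (induction k arbitrary: f g)
  case 0
  then show ?case by (simp add: continuous_map_Euclidean_open_iff[OF U] continuous_on_add)
next
  case (Suc k)
  show ?case
  proof (rule C_k_SucI[OF U, where f' = "\<lambda>i x. partial_deriv i f x + partial_deriv i g x"])
    show "continuous_on U (\<lambda>x. f x + g x)"
      using Suc.prems[THEN C_k_imp_continuous_on[OF U]] by (intro continuous_intros)
    show "C_k n U k h" if "i < n" "\<And>x. x \<in> U \<Longrightarrow> h x = partial_deriv i f x + partial_deriv i g x" for i h
      using C_k_cong[OF U Suc.IH[OF Suc.prems[THEN C_k_Suc_partial, OF that(1)]]] that(2) by blast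
  qed (intro DERIV_add Suc.prems[THEN C_k_Suc_has_partial])
qed

lemma C_k_mult:
  assumes U: "openin (Euclidean_space n) U"
  shows "C_k n U k f \<Longrightarrow> C_k n U k g \<Longrightarrow> C_k n U k (\<lambda>x. f x * g x)"
proof (induction k arbitrary: f g)
  case 0
  then show ?case by (simp add: continuous_map_Euclidean_open_iff[OF U] continuous_on_mult)
next
  case (Suc k)
  let ?f' = "\<lambda>i x. partial_deriv i f x * g x + partial_deriv i g x * f x"
  show ?case
  proof (rule C_k_SucI[OF U, where f' = ?f'])
    show "continuous_on U (\<lambda>x. f x * g x)"
      using Suc.prems[THEN C_k_imp_continuous_on[OF U]] by (intro continuous_intros)
    show "((\<lambda>t. f (x(i := t)) * g (x(i := t))) has_real_derivative ?f' i x) (at (x i))"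
      if "i < n" "x \<in> U" for i x
      using DERIV_mult[OF C_k_Suc_has_partial[OF Suc.prems(1) that] C_k_Suc_has_partial[OF Suc.prems(2) that]] by (simp only: fun_upd_triv)
    show "C_k n U k h" if "i < n" "\<And>x. x \<in> U \<Longrightarrow> h x = ?f' i x" for i h
    proof (rule C_k_cong[OF U _ that(2)])
      show "C_k n U k (?f' i)"
        using Suc.prems[THEN C_k_lower] Suc.prems[THEN C_k_Suc_partial, OF that(1)]
        by (intro C_k_add[OF U] Suc.IH)
    qed
  qed
qed

lemma C_k_sum:
  assumes "openin (Euclidean_space n) U" "\<And>j. j \<in> J \<Longrightarrow> C_k n U k (f j)"
  shows "C_k n U k (\<lambda>x. \<Sum>j\<in>J. f j x)"
  using assms(2) by (induction J rule: infinite_finite_induct) (simp_all add: C_k_const C_k_add assms(1))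

lemma C_k_coordinate:
  assumes U: "openin (Euclidean_space n) U"
  shows "C_k n U k (\<lambda>x. x j)"
proof -
  have cont: "continuous_on U (\<lambda>x. x j)"
    using continuous_on_product_then_coordinatewise[OF continuous_on_id[of U], of j] by simp
  show ?thesis
  proof (cases k)
    case (Suc k')
    have "C_k n U (Suc k') (\<lambda>x. x j)"
    proof (rule C_k_SucI[OF U cont, where f' = "\<lambda>i x. if i = j then 1 else 0"])
      show "((\<lambda>t. (x(i := t)) j) has_real_derivative (if i = j then 1 else 0)) (at (x i))" for i x
        by (cases "i = j") auto
      show "C_k n U k' g" if "\<And>x. x \<in> U \<Longrightarrow> g x = (if i = j then 1 else 0)" for i g
        using that by (intro C_k_cong[OF U C_k_const[OF U]])
    qed
    with Suc show ?thesis by simp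
  qed (simp add: continuous_map_Euclidean_open_iff[OF U] cont)
qed

lemma continuous_on_compose_real:
  fixes g :: "'a::topological_space \<Rightarrow> real"
  assumes "\<And>y. y \<in> S \<Longrightarrow> (f has_real_derivative f' y) (at y)" "g \<in> U \<rightarrow> S" "continuous_on U g"
  shows "continuous_on U (\<lambda>x. f (g x))"
proof -
  have "continuous_on S f" using assms(1) by (meson DERIV_continuous_on DERIV_subset top_greatest)
  then show ?thesis using assms(2,3) by (auto intro: continuous_on_compose2)
qed

text \<open>
  The functions \<open>F 0, F 1, \<dots>\<close> are the successive derivatives of \<open>F 0\<close>. The induction over \<open>k\<close> needs
  the statement for all of them at once, because the derivative of \<open>F j \<circ> g\<close> contains
  \<open>F (Suc j) \<circ> g\<close>.
\<close>
lemma C_k_compose_real: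
  assumes U: "openin (Euclidean_space n) U"
    and F: "\<And>j y. y \<in> S \<Longrightarrow> (F j has_real_derivative F (Suc j) y) (at y)"
    and S: "g \<in> U \<rightarrow> S"
  shows "C_k n U k g \<Longrightarrow> C_k n U k (\<lambda>x. F j (g x))"
proof (induction k arbitrary: j)
  case 0
  then show ?case using continuous_on_compose_real[OF F S] by (simp add: continuous_map_Euclidean_open_iff[OF U])
next
  case (Suc k)
  show ?case
  proof (rule C_k_SucI[OF U, where f' = "\<lambda>i x. F (Suc j) (g x) * partial_deriv i g x"])
    show "continuous_on U (\<lambda>x. F j (g x))" using continuous_on_compose_real[OF F S C_k_imp_continuous_on[OF U Suc.prems]] .
    show "((\<lambda>t. F j (g (x(i := t)))) has_real_derivative F (Suc j) (g x) * partial_deriv i g x) (at (x i))"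
      if "i < n" "x \<in> U" for i x
    proof -
      have "g x \<in> S" using S that(2) by blast
      then have "(F j has_real_derivative F (Suc j) (g x)) (at (g (x(i := x i))))"
        using F[of "g x" j] by (simp only: fun_upd_triv)
      then show ?thesis by (rule DERIV_chain2[OF _ C_k_Suc_has_partial[OF Suc.prems that]])
    qed
    show "C_k n U k h" if "i < n" "\<And>x. x \<in> U \<Longrightarrow> h x = F (Suc j) (g x) * partial_deriv i g x" for i h
    proof (rule C_k_cong[OF U _ that(2)])
      show "C_k n U k (\<lambda>x. F (Suc j) (g x) * partial_deriv i g x)"
        using C_k_mult[OF U Suc.IH[OF C_k_lower[OF Suc.prems]] C_k_Suc_partial[OF Suc.prems that(1)]] .
    qed
  qed
qed

text \<open>
  Continuous partial derivatives give total differentiability: moving from \<open>x\<close> to \<open>y\<close> one coordinate at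
  a time, each step is controlled by the mean value inequality on a box where the partial
  derivatives differ by less than \<open>e\<close> from their values at \<open>x\<close>.
\<close>
lemma C_1_linear_approximation:
  assumes U: "openin (Euclidean_space n) U" and f: "C_k n U (Suc 0) f" and x: "x \<in> U" and e: "e > 0"
  obtains d where "d > 0"
    "\<And>y. (\<And>i. i < n \<Longrightarrow> \<bar>y i - x i\<bar> < d) \<Longrightarrow> (\<And>i. i \<ge> n \<Longrightarrow> y i = 0) \<Longrightarrow>
      y \<in> U \<and> \<bar>f y - f x - (\<Sum>j<n. partial_deriv j f x * (y j - x j))\<bar> \<le> e * (\<Sum>j<n. \<bar>y j - x j\<bar>)"
proof -
  let ?W = "U \<inter> (\<Inter>j<n. {y \<in> U. \<bar>partial_deriv j f y - partial_deriv j f x\<bar> < e})"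
  have "openin (Euclidean_space n) {y \<in> U. \<bar>partial_deriv j f y - partial_deriv j f x\<bar> < e}" if "j < n" for j
  proof -
    have "continuous_on U (partial_deriv j f)"
      using C_k_imp_continuous_on[OF U C_k_Suc_partial[OF f that]] .
    then have "continuous_on U (\<lambda>y. \<bar>partial_deriv j f y - partial_deriv j f x\<bar>)"
      by (intro continuous_intros)
    then have "openin (top_of_set U) (U \<inter> (\<lambda>y. \<bar>partial_deriv j f y - partial_deriv j f x\<bar>) -` {..<e})"
      by (rule continuous_openin_preimage_gen) simp
    then have "openin (Euclidean_space n) (U \<inter> (\<lambda>y. \<bar>partial_deriv j f y - partial_deriv j f x\<bar>) -` {..<e})"
      using U unfolding Euclidean_space_def euclidean_product_topology by (rule openin_trans)
    then show ?thesis by (simp add: Int_def vimage_def)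
  qed
  then have "openin (Euclidean_space n) ?W"
    using U by (cases "n = 0") (auto intro!: openin_Int openin_INT)
  moreover have "x \<in> ?W" using x e by simp
  ultimately obtain d where d: "d > 0"
    "\<And>y. (\<And>i. i < n \<Longrightarrow> \<bar>y i - x i\<bar> < d) \<Longrightarrow> (\<And>i. i \<ge> n \<Longrightarrow> y i = 0) \<Longrightarrow> y \<in> ?W"
    by (rule openin_Euclidean_box) blast
  have x0: "x j = 0" if "j \<ge> n" for j
    using openin_subset[OF U] x that by (auto simp: topspace_Euclidean_space)
  have *: "\<bar>f y - f x - (\<Sum>j<m. partial_deriv j f x * (y j - x j))\<bar> \<le> e * (\<Sum>j<m. \<bar>y j - x j\<bar>)"
    if "m \<le> n" "\<And>i. \<bar>y i - x i\<bar> < d" "\<And>i. i \<ge> m \<Longrightarrow> y i = x i" for m y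
    using that
  proof (induction m arbitrary: y)
    case 0
    then have "y = x" by auto
    then show ?case by simp
  next
    case (Suc m)
    define y' where "y' = y(m := x m)"
    have y': "\<bar>f y' - f x - (\<Sum>j<m. partial_deriv j f x * (y j - x j))\<bar> \<le> e * (\<Sum>j<m. \<bar>y j - x j\<bar>)"
    proof -
      have "\<bar>f y' - f x - (\<Sum>j<m. partial_deriv j f x * (y' j - x j))\<bar> \<le> e * (\<Sum>j<m. \<bar>y' j - x j\<bar>)"
        using Suc.prems d(1) by (intro Suc.IH) (auto simp: y'_def le_Suc_eq)
      then show ?thesis by (simp add: y'_def)
    qed
    \<comment> \<open>Only the \<open>m\<close>-th coordinate differs between \<open>y'\<close> and \<open>y\<close>, so the mean value inequality for
      the function \<open>t \<mapsto> f (y(m := t)) - \<partial>\<^sub>mf(x) \<cdot> t\<close> compares their values.\<close>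
    let ?h = "\<lambda>t. f (y(m := t)) - partial_deriv m f x * t"
    let ?I = "{x m - d <..< x m + d}"
    have W: "y(m := t) \<in> ?W" if "t \<in> ?I" for t
      using that Suc.prems x0 by (intro d(2)) auto
    have m: "m < n" using Suc.prems by simp
    have der: "(?h has_real_derivative partial_deriv m f (y(m := t)) - partial_deriv m f x) (at t)"
      if "t \<in> ?I" for t
    proof -
      have "y(m := t) \<in> U" using W[OF that] by simp
      from C_k_Suc_has_partial[OF f m this]
      have "((\<lambda>t. f (y(m := t))) has_real_derivative partial_deriv m f (y(m := t))) (at t)" by simp
      then show ?thesis by (auto intro!: derivative_eq_intros)
    qed
    have "norm (?h (y m) - ?h (x m)) \<le> e * norm (y m - x m)"
    proof (rule field_differentiable_bound[where S = ?I])
      show "(?h has_field_derivative partial_deriv m f (y(m := t)) - partial_deriv m f x) (at t within ?I)"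
        if "t \<in> ?I" for t using der[OF that] has_field_derivative_at_within by blast
      show "norm (partial_deriv m f (y(m := t)) - partial_deriv m f x) \<le> e" if "t \<in> ?I" for t
        using W[OF that] m by (auto intro: less_imp_le)
      show "y m \<in> ?I" using Suc.prems(2)[of m] by (auto simp: abs_less_iff)
    qed (use d(1) in auto)
    then have "\<bar>f y - f y' - partial_deriv m f x * (y m - x m)\<bar> \<le> e * \<bar>y m - x m\<bar>"
      by (simp add: y'_def algebra_simps)
    then show ?case using y' by (simp add: algebra_simps)
  qed
  show thesis
  proof (rule that[OF d(1)])
    fix y assume y: "\<And>i. i < n \<Longrightarrow> \<bar>y i - x i\<bar> < d" "\<And>i. i \<ge> n \<Longrightarrow> y i = 0"
    have "\<bar>y i - x i\<bar> < d" for i using y[of i] x0[of i] d(1) by (cases "i < n") auto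
    moreover have "y i = x i" if "i \<ge> n" for i using y(2) x0 that by simp
    moreover have "y \<in> U" using d(2)[OF y] by auto
    ultimately show "y \<in> U \<and> \<bar>f y - f x - (\<Sum>j<n. partial_deriv j f x * (y j - x j))\<bar> \<le> e * (\<Sum>j<n. \<bar>y j - x j\<bar>)"
      using *[of n y] by auto
  qed
qed

text \<open>
  Only curves are needed here: the partial derivatives of \<open>f \<circ> h\<close> are derivatives of \<open>f\<close> along
  the curves that \<open>h\<close> makes of the coordinate lines.
\<close>
lemma C_1_chain_rule:
  assumes U: "openin (Euclidean_space n) U" and f: "C_k n U (Suc 0) f"
    and c: "\<forall>\<^sub>F s in nhds a. c s \<in> U"
    and c': "\<And>j. j < n \<Longrightarrow> ((\<lambda>s. c s j) has_real_derivative c' j) (at a)"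
  shows "((\<lambda>s. f (c s)) has_real_derivative (\<Sum>j<n. partial_deriv j f (c a) * c' j)) (at a)"
proof -
  let ?x = "c a"
  have ca: "?x \<in> U" using eventually_nhds_x_imp_x[OF c] .
  let ?L = "\<lambda>s. \<Sum>j<n. partial_deriv j f ?x * (c s j - ?x j)"
  let ?N = "\<lambda>s. \<Sum>j<n. \<bar>c s j - ?x j\<bar>"
  have L: "((\<lambda>s. ?L s) has_real_derivative (\<Sum>j<n. partial_deriv j f ?x * c' j)) (at a)"
    by (auto intro!: derivative_eq_intros c' simp: mult.commute)
  have q: "(\<lambda>s. (c s j - ?x j) / (s - a)) \<midarrow>a\<rightarrow> c' j" if "j < n" for j
    using c'[OF that] by (simp add: has_field_derivative_iff)
  \<comment> \<open>A bound, near \<open>a\<close>, for the difference quotients of \<open>c\<close> in the \<open>1\<close>-norm. It turns the error \<open>r / K\<close>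
    of the linear approximation of \<open>f\<close> into an error \<open>r\<close> along the curve.\<close>
  define K where "K = (\<Sum>j<n. \<bar>c' j\<bar>) + 1"
  have K: "K > 0" unfolding K_def by (smt (verit) sum_nonneg abs_ge_zero)
  have "(\<lambda>s. \<Sum>j<n. \<bar>(c s j - ?x j) / (s - a)\<bar>) \<midarrow>a\<rightarrow> (\<Sum>j<n. \<bar>c' j\<bar>)"
    by (intro tendsto_sum tendsto_rabs q) auto
  then have "\<forall>\<^sub>F s in at a. (\<Sum>j<n. \<bar>(c s j - ?x j) / (s - a)\<bar>) < K"
    by (rule order_tendstoD) (simp add: K_def)
  then have NK: "\<forall>\<^sub>F s in at a. ?N s / \<bar>s - a\<bar> < K"
    by (simp add: abs_divide sum_divide_distrib)
  have cont: "\<forall>\<^sub>F s in at a. \<bar>c s j - ?x j\<bar> < d" if "j < n" "d > 0" for j d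
    using DERIV_isCont[OF c'[OF that(1)]] that(2)
    by (auto simp: isCont_def tendsto_iff dist_real_def)
  have "(\<lambda>s. (f (c s) - f ?x - ?L s) / (s - a)) \<midarrow>a\<rightarrow> 0"
    unfolding tendsto_iff dist_real_def
  proof (intro allI impI)
    fix r :: real assume "r > 0"
    then have rK: "r / K > 0" using K by simp
    obtain d where d: "d > 0"
      "\<And>y. (\<And>i. i < n \<Longrightarrow> \<bar>y i - ?x i\<bar> < d) \<Longrightarrow> (\<And>i. i \<ge> n \<Longrightarrow> y i = 0) \<Longrightarrow>
        y \<in> U \<and> \<bar>f y - f ?x - (\<Sum>j<n. partial_deriv j f ?x * (y j - ?x j))\<bar> \<le> r / K * (\<Sum>j<n. \<bar>y j - ?x j\<bar>)"
      using C_1_linear_approximation[OF U f ca rK] by blast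
    have "\<forall>\<^sub>F s in at a. \<forall>j\<in>{..<n}. \<bar>c s j - ?x j\<bar> < d"
      by (rule eventually_ball_finite) (use cont d(1) in auto)
    moreover have "\<forall>\<^sub>F s in at a. c s \<in> U" using c eventually_nhds_conv_at by blast
    moreover have "\<forall>\<^sub>F s in at a. s \<noteq> a" by (simp add: eventually_at_filter)
    ultimately show "\<forall>\<^sub>F s in at a. \<bar>(f (c s) - f ?x - ?L s) / (s - a) - 0\<bar> < r"
      using NK
    proof eventually_elim
      case (elim s)
      have "c s i = 0" if "i \<ge> n" for i
        using elim(2) openin_subset[OF U] that by (auto simp: topspace_Euclidean_space)
      then have "\<bar>f (c s) - f ?x - ?L s\<bar> \<le> r / K * ?N s" using elim(1) d(2)[of "c s"] by auto
      then have "\<bar>(f (c s) - f ?x - ?L s) / (s - a)\<bar> \<le> r / K * (?N s / \<bar>s - a\<bar>)"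
        using divide_right_mono[of _ _ "\<bar>s - a\<bar>"] by (simp only: abs_divide times_divide_eq_right)
      also have "\<dots> < r / K * K" using elim(4) rK by (intro mult_strict_left_mono)
      also have "\<dots> = r" using K by simp
      finally show ?case by simp
    qed
  qed
  moreover have "?L a = 0" by simp
  ultimately have "((\<lambda>s. f (c s) - f ?x - ?L s) has_real_derivative 0) (at a)"
    by (simp add: has_field_derivative_iff)
  from DERIV_add[OF DERIV_add[OF this L] DERIV_const[of "f ?x"]] show ?thesis by simp
qed

lemma C_k_subset:
  assumes "V \<subseteq> U" "C_k n U k f"
  shows "C_k n V k f"
  using assms(2)
proof (induction k arbitrary: f)
  case 0
  then show ?case using assms(1) by (simp add: continuous_map_from_subtopology_mono)
next
  case (Suc k)
  then show ?case using assms(1) by (auto simp: C_k.simps(2) intro: continuous_map_from_subtopology_mono)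
qed

lemma continuous_map_local:
  assumes "\<And>x. x \<in> U \<Longrightarrow> \<exists>V. openin X V \<and> x \<in> V \<and> V \<subseteq> U \<and> continuous_map (subtopology X V) Y f"
  shows "continuous_map (subtopology X U) Y f"
proof (rule pasting_lemma[where f = "\<lambda>_. f" and T = id
      and I = "{V. openin X V \<and> V \<subseteq> U \<and> continuous_map (subtopology X V) Y f}"])
  show "openin (subtopology X U) (id V)"
    if "V \<in> {V. openin X V \<and> V \<subseteq> U \<and> continuous_map (subtopology X V) Y f}" for V
    using that openin_subset_topspace_eq by (auto simp: openin_subtopology)
  show "continuous_map (subtopology (subtopology X U) (id V)) Y f"
    if "V \<in> {V. openin X V \<and> V \<subseteq> U \<and> continuous_map (subtopology X V) Y f}" for V
    using that by (auto simp: subtopology_subtopology Int_absorb1)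
  show "\<exists>V. V \<in> {V. openin X V \<and> V \<subseteq> U \<and> continuous_map (subtopology X V) Y f} \<and> x \<in> id V \<and> f x = f x"
    if "x \<in> topspace (subtopology X U)" for x
    using assms[of x] that by auto
qed auto

lemma C_k_local:
  assumes "\<And>x. x \<in> U \<Longrightarrow> \<exists>V. openin (Euclidean_space n) V \<and> x \<in> V \<and> V \<subseteq> U \<and> C_k n V k f"
  shows "C_k n U k f"
  using assms
proof (induction k arbitrary: f)
  case 0
  then show ?case by (simp add: continuous_map_local)
next
  case (Suc k)
  have V: "\<exists>V. openin (Euclidean_space n) V \<and> x \<in> V \<and> V \<subseteq> U \<and>
      continuous_map (subtopology (Euclidean_space n) V) euclideanreal f \<and>
      (\<forall>i<n. C_k n V k (partial_deriv i f))" if x: "x \<in> U" for x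
  proof -
    obtain V where "openin (Euclidean_space n) V" "x \<in> V" "V \<subseteq> U" "C_k n V (Suc k) f"
      using Suc.prems[OF x] by blast
    then show ?thesis by (intro exI[of _ V]) (simp add: C_k.simps(2))
  qed
  have "continuous_map (subtopology (Euclidean_space n) U) euclideanreal f"
    by (rule continuous_map_local) (use V in blast)
  moreover have "(\<lambda>t. f (x(i := t))) field_differentiable at (x i)" if "i < n" "x \<in> U" for i x
    using Suc.prems[OF that(2)] that(1) by (auto simp: C_k.simps(2))
  moreover have "C_k n U k (partial_deriv i f)" if "i < n" for i
    by (rule Suc.IH) (use V that in blast)
  ultimately show ?case by (simp add: C_k.simps(2))
qed

lemma smooth_fun_openin: "smooth_fun n U f \<Longrightarrow> openin (Euclidean_space n) U"
  by (simp add: smooth_fun_def)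

lemma smooth_fun_continuous_on: "smooth_fun n U f \<Longrightarrow> continuous_on U f"
  by (auto simp: smooth_fun_def intro: C_k_imp_continuous_on)

lemma smooth_fun_cong: "smooth_fun n U f \<Longrightarrow> (\<And>x. x \<in> U \<Longrightarrow> g x = f x) \<Longrightarrow> smooth_fun n U g"
  unfolding smooth_fun_def using C_k_cong by blast

lemma smooth_fun_local:
  assumes "openin (Euclidean_space n) U"
    "\<And>x. x \<in> U \<Longrightarrow> \<exists>V. openin (Euclidean_space n) V \<and> x \<in> V \<and> V \<subseteq> U \<and> smooth_fun n V f"
  shows "smooth_fun n U f"
  unfolding smooth_fun_def
proof (intro conjI allI)
  show "C_k n U k f" for k
    by (rule C_k_local) (use assms(2) in \<open>simp only: smooth_fun_def, meson\<close>)
qed (rule assms)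

lemma smooth_fun_subset:
  "smooth_fun n U f \<Longrightarrow> openin (Euclidean_space n) V \<Longrightarrow> V \<subseteq> U \<Longrightarrow> smooth_fun n V f"
  by (auto simp: smooth_fun_def intro: C_k_subset)

lemma smooth_fun_const: "openin (Euclidean_space n) U \<Longrightarrow> smooth_fun n U (\<lambda>_. c)"
  by (simp add: smooth_fun_def C_k_const)

lemma smooth_fun_coordinate: "openin (Euclidean_space n) U \<Longrightarrow> smooth_fun n U (\<lambda>x. x i)"
  by (simp add: smooth_fun_def C_k_coordinate)

lemma smooth_fun_add: "smooth_fun n U f \<Longrightarrow> smooth_fun n U g \<Longrightarrow> smooth_fun n U (\<lambda>x. f x + g x)"
  by (simp add: smooth_fun_def C_k_add)

lemma smooth_fun_mult: "smooth_fun n U f \<Longrightarrow> smooth_fun n U g \<Longrightarrow> smooth_fun n U (\<lambda>x. f x * g x)"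
  by (simp add: smooth_fun_def C_k_mult)

lemma smooth_fun_diff:
  assumes "smooth_fun n U f" "smooth_fun n U g"
  shows "smooth_fun n U (\<lambda>x. f x - g x)"
  using smooth_fun_add[OF assms(1) smooth_fun_mult[OF smooth_fun_const[of n U "-1"] assms(2)]]
    smooth_fun_openin[OF assms(1)] by simp

lemma smooth_fun_sum:
  "openin (Euclidean_space n) U \<Longrightarrow> (\<And>j. j \<in> J \<Longrightarrow> smooth_fun n U (f j)) \<Longrightarrow>
    smooth_fun n U (\<lambda>x. \<Sum>j\<in>J. f j x)"
  by (simp add: smooth_fun_def C_k_sum)

lemma smooth_fun_compose_real:
  assumes "\<And>j y. y \<in> S \<Longrightarrow> (F j has_real_derivative F (Suc j) y) (at y)"
    and "smooth_fun n U g" "g \<in> U \<rightarrow> S"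
  shows "smooth_fun n U (\<lambda>x. F j (g x))"
  using assms(2) C_k_compose_real[where F = F, OF _ assms(1) assms(3)] unfolding smooth_fun_def by simp

lemma smooth_fun_divide:
  assumes "smooth_fun n U f" "smooth_fun n U g" "\<And>x. x \<in> U \<Longrightarrow> g x \<noteq> 0"
  shows "smooth_fun n U (\<lambda>x. f x / g x)"
proof -
  \<comment> \<open>The successive derivatives of \<open>y \<mapsto> 1 / y\<close>.\<close>
  let ?F = "\<lambda>j y. (- 1) ^ j * fact j / y ^ Suc j :: real"
  have "(?F j has_real_derivative ?F (Suc j) y) (at y)" if "y \<in> - {0}" for j y
  proof -
    have y: "y \<noteq> 0" using that by simp
    then show ?thesis
      by (auto intro!: derivative_eq_intros simp: field_simps power_add simp del: power_Suc)
        (simp add: field_simps)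
  qed
  then have "smooth_fun n U (\<lambda>x. ?F 0 (g x))"
    by (rule smooth_fun_compose_real[where S = "- {0}"]) (use assms in auto)
  from smooth_fun_mult[OF assms(1) this] show ?thesis by simp
qed

lemma smooth_fun_partial_deriv:
  "smooth_fun n U f \<Longrightarrow> i < n \<Longrightarrow> smooth_fun n U (partial_deriv i f)"
  unfolding smooth_fun_def using C_k_Suc_partial by blast

lemma smooth_fun_openin_preimage:
  assumes "smooth_fun n U f" "open S"
  shows "openin (Euclidean_space n) {x \<in> U. f x \<in> S}"
proof -
  have U: "openin (Euclidean_space n) U" using assms(1) by (rule smooth_fun_openin)
  have "openin (top_of_set U) (U \<inter> f -` S)"
    using assms by (intro continuous_openin_preimage_gen smooth_fun_continuous_on)
  then have "openin (Euclidean_space n) (U \<inter> f -` S)"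
    using U unfolding Euclidean_space_def euclidean_product_topology by (rule openin_trans)
  then show ?thesis by (simp add: Int_def vimage_def)
qed

lemma smooth_map_continuous_on:
  assumes h: "smooth_map m V n U h"
  shows "continuous_on V h"
proof -
  have V: "openin (Euclidean_space m) V" and hU: "h \<in> V \<rightarrow> U" and U: "openin (Euclidean_space n) U"
    using h by (auto simp: smooth_map_def)
  have h0: "h v i = 0" if "v \<in> V" "i \<ge> n" for v i
    using openin_subset[OF U] hU that by (auto simp: topspace_Euclidean_space)
  have "continuous_on V (\<lambda>v. h v i)" for i
  proof (cases "i < n")
    case True
    then show ?thesis using h by (auto simp: smooth_map_def intro: smooth_fun_continuous_on)
  next
    case False
    then show ?thesis using h0 continuous_on_cong[of V V "\<lambda>v. h v i" "\<lambda>_. 0"] by simp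
  qed
  then show ?thesis by (rule continuous_on_coordinatewise_then_product)
qed

lemma smooth_map_openin_preimage:
  assumes h: "smooth_map m V n U h" and W: "openin (Euclidean_space n) W"
  shows "openin (Euclidean_space m) {v \<in> V. h v \<in> W}"
proof -
  have V: "openin (Euclidean_space m) V" and hU: "h \<in> V \<rightarrow> U" and U: "openin (Euclidean_space n) U"
    using h by (auto simp: smooth_map_def)
  have h0: "h v i = 0" if "v \<in> V" "i \<ge> n" for v i
    using openin_subset[OF U] hU that by (auto simp: topspace_Euclidean_space)
  obtain T where T: "open T" "W = T \<inter> {x. \<forall>i\<ge>n. x i = 0}"
    using W by (auto simp: Euclidean_space_def openin_subtopology euclidean_product_topology)
  from smooth_map_continuous_on[OF h] T(1) have "openin (top_of_set V) (V \<inter> h -` T)"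
    by (rule continuous_openin_preimage_gen)
  then have "openin (Euclidean_space m) (V \<inter> h -` T)"
    using V unfolding Euclidean_space_def euclidean_product_topology by (rule openin_trans)
  moreover have "V \<inter> h -` T = {v \<in> V. h v \<in> W}" using T(2) h0 by auto
  ultimately show ?thesis by simp
qed

lemma smooth_map_inclusion:
  "openin (Euclidean_space n) V \<Longrightarrow> openin (Euclidean_space n) U \<Longrightarrow> V \<subseteq> U \<Longrightarrow> smooth_map n V n U id"
  by (auto simp: smooth_map_def intro: smooth_fun_coordinate)

text \<open>
  By the chain rule the partial derivatives of \<open>f \<circ> h\<close> are sums of products of \<open>\<partial>\<^sub>jf \<circ> h\<close>
  with derivatives of the components of \<open>h\<close>, so that \<open>C\<^sup>k\<close> regularity follows by induction over \<open>k\<close> for all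
  smooth \<open>f\<close> simultaneously.
\<close>
lemma smooth_fun_compose_smooth_map:
  assumes f: "smooth_fun n U f" and h: "smooth_map m V n U h"
  shows "smooth_fun m V (\<lambda>x. f (h x))"
proof -
  have U: "openin (Euclidean_space n) U" and V: "openin (Euclidean_space m) V" and hU: "h \<in> V \<rightarrow> U"
    and hj: "\<And>j. j < n \<Longrightarrow> smooth_fun m V (\<lambda>x. h x j)"
    using h by (auto simp: smooth_map_def)
  have cont: "continuous_on V (\<lambda>x. f (h x))" if "smooth_fun n U f" for f
    using continuous_on_compose2[OF smooth_fun_continuous_on[OF that] smooth_map_continuous_on[OF h]] hU
    by auto
  have "C_k m V k (\<lambda>x. f (h x))" for k
    using f
  proof (induction k arbitrary: f)
    case 0
    then show ?case by (simp add: continuous_map_Euclidean_open_iff[OF V] cont)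
  next
    case (Suc k)
    let ?d = "\<lambda>i x. \<Sum>j<n. partial_deriv j f (h x) * partial_deriv i (\<lambda>x. h x j) x"
    show ?case
    proof (rule C_k_SucI[OF V cont[OF Suc.prems], where f' = ?d])
      show "((\<lambda>t. f (h (x(i := t)))) has_real_derivative ?d i x) (at (x i))"
        if "i < m" "x \<in> V" for i x
      proof -
        have "C_k n U (Suc 0) f" using Suc.prems by (simp only: smooth_fun_def)
        moreover have "\<forall>\<^sub>F s in nhds (x i). h (x(i := s)) \<in> U"
          using eventually_coordinate_line[OF V that(2,1)] by eventually_elim (use hU in blast)
        moreover have "((\<lambda>s. h (x(i := s)) j) has_real_derivative partial_deriv i (\<lambda>x. h x j) x) (at (x i))"
          if j: "j < n" for j
        proof -
          have "C_k m V (Suc 0) (\<lambda>x. h x j)" using hj[OF j] by (simp only: smooth_fun_def)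
          from C_k_Suc_has_partial[OF this \<open>i < m\<close> \<open>x \<in> V\<close>] show ?thesis .
        qed
        ultimately show ?thesis
          using C_1_chain_rule[OF U, of f "\<lambda>s. h (x(i := s))" "x i" "\<lambda>j. partial_deriv i (\<lambda>x. h x j) x"]
          by (simp only: fun_upd_triv)
      qed
      show "C_k m V k g" if "i < m" "\<And>x. x \<in> V \<Longrightarrow> g x = ?d i x" for i g
      proof (rule C_k_cong[OF V C_k_sum[OF V C_k_mult[OF V]] that(2)])
        fix j assume "j \<in> {..<n}"
        then have j: "j < n" by simp
        show "C_k m V k (\<lambda>x. partial_deriv j f (h x))"
          by (rule Suc.IH[OF smooth_fun_partial_deriv[OF Suc.prems j]])
        show "C_k m V k (partial_deriv i (\<lambda>x. h x j))"
          using smooth_fun_partial_deriv[OF hj[OF j] that(1)] by (simp add: smooth_fun_def)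
      qed
    qed
  qed
  with V show ?thesis by (simp add: smooth_fun_def)
qed

lemma smooth_map_compose:
  assumes "smooth_map m V n U h" "smooth_map l W m V k"
  shows "smooth_map l W n U (h \<circ> k)"
  using assms smooth_fun_compose_smooth_map[OF _ assms(2)]
  unfolding smooth_map_def by (auto simp: Pi_iff)

section \<open>The flat exponential function\<close>

text \<open>
  The \<open>j\<close>-th derivative of \<open>x \<mapsto> exp (- 1 / x)\<close> is \<open>p\<^sub>j (1 / x) * exp (- 1 / x)\<close> for a polynomial \<open>p\<^sub>j\<close>, and
  differentiating once more gives the recursion \<open>p\<^sub>j\<^sub>+\<^sub>1 = X\<^sup>2 (p\<^sub>j - p\<^sub>j')\<close>.
\<close>
primrec flat_exp_poly :: "nat \<Rightarrow> real poly" where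
  "flat_exp_poly 0 = 1"
| "flat_exp_poly (Suc j) = [:0, 0, 1:] * (flat_exp_poly j - pderiv (flat_exp_poly j))"

text \<open>
  The function of interest is \<open>flat_exp 0\<close>; \<open>flat_exp j\<close> is its \<open>j\<close>-th derivative, and all of these
  vanish at \<open>0\<close>.
\<close>
definition flat_exp :: "nat \<Rightarrow> real \<Rightarrow> real" where
  "flat_exp j x = (if x > 0 then poly (flat_exp_poly j) (1 / x) * exp (- (1 / x)) else 0)"

lemma poly_times_exp_minus_tendsto_0: "((\<lambda>y::real. poly p y * exp (- y)) \<longlongrightarrow> 0) at_top"
proof -
  have "((\<lambda>y. \<Sum>i\<le>degree p. coeff p i * (y ^ i / exp y)) \<longlongrightarrow> (\<Sum>i\<le>degree p. coeff p i * 0)) at_top"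
    by (intro tendsto_intros tendsto_power_div_exp_0)
  then show ?thesis
    by (simp add: poly_altdef sum_distrib_right exp_minus divide_inverse mult.assoc)
qed

text \<open>
  At \<open>0\<close> the difference quotient from the right is \<open>y * p\<^sub>j y * exp (- y)\<close> for \<open>y = 1 / x \<rightarrow> \<infinity>\<close>, which
  tends to \<open>0\<close> as the exponential function outgrows every polynomial.
\<close>
lemma flat_exp_has_derivative: "(flat_exp j has_real_derivative flat_exp (Suc j) x) (at x)"
proof -
  let ?g = "\<lambda>x. poly (flat_exp_poly j) (1 / x) * exp (- (1 / x))"
  consider "x > 0" | "x < 0" | "x = 0" by linarith
  then show ?thesis
  proof cases
    case 1
    have "((\<lambda>x. poly (flat_exp_poly j) (1 / x)) has_real_derivative
        poly (pderiv (flat_exp_poly j)) (1 / x) * (- (1 / x ^ 2))) (at x)"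
      by (rule DERIV_chain2[OF poly_DERIV]) (use 1 in \<open>auto intro!: derivative_eq_intros simp: power2_eq_square\<close>)
    moreover have "((\<lambda>x. exp (- (1 / x))) has_real_derivative exp (- (1 / x)) * (1 / x ^ 2)) (at x)"
      using 1 by (auto intro!: derivative_eq_intros simp: power2_eq_square)
    ultimately have "(?g has_real_derivative flat_exp (Suc j) x) (at x)"
      by (rule DERIV_cong[OF DERIV_mult]) (use 1 in \<open>simp add: flat_exp_def field_simps power2_eq_square\<close>)
    moreover have "\<forall>\<^sub>F y in nhds x. flat_exp j y = ?g y"
      using eventually_nhds_in_open[of "{0<..}" x] 1 by (auto elim!: eventually_mono simp: flat_exp_def)
    ultimately show ?thesis by (subst DERIV_cong_ev) auto
  next
    case 2
    have "\<forall>\<^sub>F y in nhds x. flat_exp j y = 0"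
      using eventually_nhds_in_open[of "{..<0}" x] 2 by (auto elim!: eventually_mono simp: flat_exp_def)
    then show ?thesis using 2 by (subst DERIV_cong_ev[where g = "\<lambda>_. 0"]) (auto simp: flat_exp_def)
  next
    case 3
    have "((\<lambda>h. flat_exp j h / h) \<longlongrightarrow> 0) (at_right 0)"
    proof -
      have "((\<lambda>h. poly ([:0, 1:] * flat_exp_poly j) (inverse h) * exp (- inverse h)) \<longlongrightarrow> 0) (at_right (0::real))"
        by (rule filterlim_compose[OF poly_times_exp_minus_tendsto_0 filterlim_inverse_at_top_right])
      moreover have "\<forall>\<^sub>F h in at_right 0. poly ([:0, 1:] * flat_exp_poly j) (inverse h) * exp (- inverse h) = flat_exp j h / h"
        by (auto simp: eventually_at_filter flat_exp_def field_simps)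
      ultimately show ?thesis by (rule Lim_transform_eventually)
    qed
    moreover have "((\<lambda>h. flat_exp j h / h) \<longlongrightarrow> 0) (at_left 0)"
      by (rule tendsto_eventually) (auto simp: eventually_at_filter flat_exp_def)
    ultimately have "((\<lambda>h. flat_exp j h / h) \<longlongrightarrow> 0) (at 0)" by (simp add: filterlim_split_at)
    then show ?thesis using 3 by (simp add: has_field_derivative_iff flat_exp_def)
  qed
qed

lemma flat_exp_pos: "x > 0 \<Longrightarrow> flat_exp 0 x > 0" and flat_exp_nonpos: "x \<le> 0 \<Longrightarrow> flat_exp 0 x = 0"
  by (simp_all add: flat_exp_def)

lemma flat_exp_nonneg: "flat_exp 0 x \<ge> 0"
  by (simp add: flat_exp_def)

lemma smooth_fun_flat_exp: "smooth_fun n U g \<Longrightarrow> smooth_fun n U (\<lambda>x. flat_exp 0 (g x))"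
  by (rule smooth_fun_compose_real[where S = UNIV]) (auto intro: flat_exp_has_derivative)

section \<open>Diffeological spaces\<close>

lemma diffeological_spaceI:
  assumes "\<And>n U p. plot X n U p \<Longrightarrow> openin (Euclidean_space n) U"
    and "\<And>n U p u. plot X n U p \<Longrightarrow> u \<in> U \<Longrightarrow> p u \<in> pts X"
    and "\<And>n U p q. plot X n U p \<Longrightarrow> (\<And>u. u \<in> U \<Longrightarrow> q u = p u) \<Longrightarrow> plot X n U q"
    and "\<And>n U x. openin (Euclidean_space n) U \<Longrightarrow> x \<in> pts X \<Longrightarrow> plot X n U (\<lambda>_. x)"
    and "\<And>m V n U h p. plot X n U p \<Longrightarrow> smooth_map m V n U h \<Longrightarrow> plot X m V (\<lambda>v. p (h v))"
    and "\<And>n U p. openin (Euclidean_space n) U \<Longrightarrow>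
        (\<And>u. u \<in> U \<Longrightarrow> \<exists>V. openin (Euclidean_space n) V \<and> u \<in> V \<and> V \<subseteq> U \<and> plot X n V p) \<Longrightarrow> plot X n U p"
  shows "diffeological_space X"
  unfolding diffeological_space_def
proof (intro conjI allI impI)
  fix n U p q assume "plot X n U p \<and> (\<forall>u\<in>U. q u = p u)"
  then show "plot X n U q" using assms(3)[of n U p q] by simp
next
  fix m V n U h p assume "plot X n U p \<and> smooth_map m V n U h"
  then show "plot X m V (p \<circ> h)" using assms(5)[of n U p m V h] by (simp add: o_def)
next
  fix n U p
  assume "openin (Euclidean_space n) U \<and>
    (\<forall>u\<in>U. \<exists>V. openin (Euclidean_space n) V \<and> u \<in> V \<and> V \<subseteq> U \<and> plot X n V p)"
  then show "plot X n U p" using assms(6)[of n U p] by simp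
qed (simp_all add: Pi_iff assms(1,2,4))

lemma diffeological_spaceD:
  assumes "diffeological_space X"
  shows "\<forall>n U p. plot X n U p \<longrightarrow> openin (Euclidean_space n) U \<and> p \<in> U \<rightarrow> pts X"
    "\<forall>n U p q. plot X n U p \<and> (\<forall>u\<in>U. q u = p u) \<longrightarrow> plot X n U q"
    "\<forall>n U x. openin (Euclidean_space n) U \<and> x \<in> pts X \<longrightarrow> plot X n U (\<lambda>_. x)"
    "\<forall>m V n U h p. plot X n U p \<and> smooth_map m V n U h \<longrightarrow> plot X m V (p \<circ> h)"
    "\<forall>n U p. openin (Euclidean_space n) U \<and>
       (\<forall>u\<in>U. \<exists>V. openin (Euclidean_space n) V \<and> u \<in> V \<and> V \<subseteq> U \<and> plot X n V p) \<longrightarrow> plot X n U p"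
  using assms unfolding diffeological_space_def by - (elim conjE, assumption)+

lemma plot_openin: "diffeological_space X \<Longrightarrow> plot X n U p \<Longrightarrow> openin (Euclidean_space n) U"
  by (rule diffeological_spaceD(1)[rule_format, THEN conjunct1])

lemma plot_in_pts:
  assumes "diffeological_space X" "plot X n U p" "u \<in> U"
  shows "p u \<in> pts X"
  using diffeological_spaceD(1)[rule_format, OF assms(1,2)] assms(3) by (simp add: Pi_iff)

lemma plot_cong:
  assumes "diffeological_space X" "plot X n U p" "\<And>u. u \<in> U \<Longrightarrow> q u = p u"
  shows "plot X n U q"
  by (rule diffeological_spaceD(2)[rule_format, OF assms(1), of n U p]) (simp add: assms)

lemma plot_const:
  "diffeological_space X \<Longrightarrow> openin (Euclidean_space n) U \<Longrightarrow> x \<in> pts X \<Longrightarrow> plot X n U (\<lambda>_. x)"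
  by (rule diffeological_spaceD(3)[rule_format, OF _ conjI])

lemma plot_compose:
  assumes "diffeological_space X" "plot X n U p" "smooth_map m V n U h"
  shows "plot X m V (\<lambda>v. p (h v))"
  using diffeological_spaceD(4)[rule_format, OF assms(1) conjI[OF assms(2,3)]] by (simp add: o_def)

lemma plot_local:
  assumes "diffeological_space X" "openin (Euclidean_space n) U"
    "\<And>u. u \<in> U \<Longrightarrow> \<exists>V. openin (Euclidean_space n) V \<and> u \<in> V \<and> V \<subseteq> U \<and> plot X n V p"
  shows "plot X n U p"
  by (rule diffeological_spaceD(5)[rule_format, OF assms(1)]) (simp add: assms(2,3))

lemma plot_subset:
  assumes "diffeological_space X" "plot X n U p" "openin (Euclidean_space n) V" "V \<subseteq> U"
  shows "plot X n V p"
  using plot_compose[OF assms(1,2) smooth_map_inclusion[OF assms(3) plot_openin[OF assms(1,2)] assms(4)]]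
  by simp

lemma locally_mono:
  assumes "\<exists>V. openin X V \<and> u \<in> V \<and> V \<subseteq> U \<and> P V" "\<And>V. P V \<Longrightarrow> Q V"
  shows "\<exists>V. openin X V \<and> u \<in> V \<and> V \<subseteq> U \<and> Q V"
  using assms by blast

lemma dsmoothI:
  assumes "\<And>x. x \<in> pts X \<Longrightarrow> f x \<in> pts Y"
    and "\<And>n U p. plot X n U p \<Longrightarrow> plot Y n U (\<lambda>u. f (p u))"
  shows "dsmooth X Y f"
  using assms by (auto simp: dsmooth_def o_def)

lemma dsmooth_in_pts: "dsmooth X Y f \<Longrightarrow> x \<in> pts X \<Longrightarrow> f x \<in> pts Y"
  by (auto simp: dsmooth_def)

lemma dsmooth_plot: "dsmooth X Y f \<Longrightarrow> plot X n U p \<Longrightarrow> plot Y n U (\<lambda>u. f (p u))"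
  by (auto simp: dsmooth_def o_def)

lemma dsmooth_compose: "dsmooth Y Z g \<Longrightarrow> dsmooth X Y f \<Longrightarrow> dsmooth X Z (\<lambda>x. g (f x))"
  by (intro dsmoothI) (auto intro: dsmooth_in_pts dsmooth_plot[of Y Z g] dsmooth_plot[of X Y f])

lemma real_diff_simps [simp]: "pts real_diff = UNIV" "plot real_diff = smooth_fun"
  by (simp_all add: real_diff_def)

lemma euclid_diff_simps [simp]:
  "pts (euclid_diff n U) = U" "plot (euclid_diff n U) m V h = smooth_map m V n U h"
  by (simp_all add: euclid_diff_def)

lemma prod_diff_simps [simp]:
  "pts (prod_diff X Y) = pts X \<times> pts Y"
  "plot (prod_diff X Y) n U p \<longleftrightarrow> plot X n U (\<lambda>u. fst (p u)) \<and> plot Y n U (\<lambda>u. snd (p u))"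
  by (simp_all add: prod_diff_def o_def)

lemma seq_diff_simps [simp]:
  "pts (seq_diff X) = {g. \<forall>i. g i \<in> pts X}"
  "plot (seq_diff X) n U p \<longleftrightarrow> (\<forall>i. plot X n U (\<lambda>u. p u i))"
  by (simp_all add: seq_diff_def)

lemma sub_diff_simps [simp]:
  "pts (sub_diff X A) = pts X \<inter> A"
  "plot (sub_diff X A) n U p \<longleftrightarrow> plot X n U p \<and> (\<forall>u\<in>U. p u \<in> A)"
  by (auto simp: sub_diff_def)

lemma pts_quot_diff [simp]: "pts (quot_diff X R) = pts X // R"
  by (simp add: quot_diff_def)

lemma plot_quot_diff:
  "plot (quot_diff X R) n U p \<longleftrightarrow> openin (Euclidean_space n) U \<and>
    (\<forall>u\<in>U. \<exists>V q. openin (Euclidean_space n) V \<and> u \<in> V \<and> V \<subseteq> U \<and>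
       plot X n V q \<and> (\<forall>v\<in>V. p v = R `` {q v}))"
  by (simp add: quot_diff_def)

lemma plot_quot_diffE:
  assumes "plot (quot_diff X R) n U p" "u \<in> U"
  obtains V q where "openin (Euclidean_space n) V" "u \<in> V" "V \<subseteq> U" "plot X n V q"
    "\<forall>v\<in>V. p v = R `` {q v}"
proof -
  have "\<exists>V q. openin (Euclidean_space n) V \<and> u \<in> V \<and> V \<subseteq> U \<and> plot X n V q \<and> (\<forall>v\<in>V. p v = R `` {q v})"
    using assms by (simp add: plot_quot_diff)
  then obtain V q where "openin (Euclidean_space n) V \<and> u \<in> V \<and> V \<subseteq> U \<and> plot X n V q \<and> (\<forall>v\<in>V. p v = R `` {q v})" by blast
  then show thesis by (intro that[of V q]) simp_all
qed

lemma diffeological_space_euclid: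
  assumes U: "openin (Euclidean_space n) U"
  shows "diffeological_space (euclid_diff n U)"
proof (rule diffeological_spaceI)
  fix m V p q assume "plot (euclid_diff n U) m V p" "\<And>u. u \<in> V \<Longrightarrow> q u = p u"
  then show "plot (euclid_diff n U) m V q"
    by (auto simp: smooth_map_def Pi_iff intro: smooth_fun_cong)
next
  fix l W m V h p assume "plot (euclid_diff n U) m V p" "smooth_map l W m V h"
  then show "plot (euclid_diff n U) l W (\<lambda>v. p (h v))"
    using smooth_map_compose[of m V n U p l W h] by (simp add: o_def)
next
  fix m V p
  assume V: "openin (Euclidean_space m) V"
    and loc: "\<And>u. u \<in> V \<Longrightarrow> \<exists>W. openin (Euclidean_space m) W \<and> u \<in> W \<and> W \<subseteq> V \<and> plot (euclid_diff n U) m W p"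
  have "p \<in> V \<rightarrow> U" using loc by (fastforce simp: smooth_map_def)
  moreover have "smooth_fun m V (\<lambda>x. p x i)" if "i < n" for i
    by (rule smooth_fun_local[OF V], drule loc, erule locally_mono) (simp add: smooth_map_def that)
  ultimately show "plot (euclid_diff n U) m V p" using V U by (simp add: smooth_map_def)
qed (use U in \<open>auto simp: smooth_map_def intro: smooth_fun_const\<close>)

lemma diffeological_space_prod:
  assumes X: "diffeological_space X" and Y: "diffeological_space Y"
  shows "diffeological_space (prod_diff X Y)"
proof (rule diffeological_spaceI)
  fix n U p u assume "plot (prod_diff X Y) n U p" "u \<in> U"
  then show "p u \<in> pts (prod_diff X Y)"
    using plot_in_pts[OF X, of n U "\<lambda>u. fst (p u)"] plot_in_pts[OF Y, of n U "\<lambda>u. snd (p u)"]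
    by (auto simp: mem_Times_iff)
next
  fix n U p q assume "plot (prod_diff X Y) n U p" "\<And>u. u \<in> U \<Longrightarrow> q u = p u"
  then show "plot (prod_diff X Y) n U q"
    using plot_cong[OF X, of n U "\<lambda>u. fst (p u)" "\<lambda>u. fst (q u)"]
      plot_cong[OF Y, of n U "\<lambda>u. snd (p u)" "\<lambda>u. snd (q u)"] by simp
next
  fix n U p
  assume U: "openin (Euclidean_space n) U"
    and loc: "\<And>u. u \<in> U \<Longrightarrow> \<exists>V. openin (Euclidean_space n) V \<and> u \<in> V \<and> V \<subseteq> U \<and> plot (prod_diff X Y) n V p"
  have "plot X n U (\<lambda>u. fst (p u))" by (rule plot_local[OF X U], drule loc, erule locally_mono) simp
  moreover have "plot Y n U (\<lambda>u. snd (p u))" by (rule plot_local[OF Y U], drule loc, erule locally_mono) simp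
  ultimately show "plot (prod_diff X Y) n U p" by simp
qed (use X Y in \<open>auto intro: plot_openin plot_const plot_compose\<close>)

lemma diffeological_space_seq:
  assumes X: "diffeological_space X"
  shows "diffeological_space (seq_diff X)"
proof (rule diffeological_spaceI)
  fix n U p u assume "plot (seq_diff X) n U p" "u \<in> U"
  then show "p u \<in> pts (seq_diff X)"
    using plot_in_pts[OF X, of n U "\<lambda>u. p u i" for i] by auto
next
  fix n U p q assume "plot (seq_diff X) n U p" "\<And>u. u \<in> U \<Longrightarrow> q u = p u"
  then show "plot (seq_diff X) n U q"
    using plot_cong[OF X, of n U "\<lambda>u. p u i" "\<lambda>u. q u i" for i] by simp
next
  fix n U p
  assume U: "openin (Euclidean_space n) U"
    and loc: "\<And>u. u \<in> U \<Longrightarrow> \<exists>V. openin (Euclidean_space n) V \<and> u \<in> V \<and> V \<subseteq> U \<and> plot (seq_diff X) n V p"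
  have "plot X n U (\<lambda>u. p u i)" for i by (rule plot_local[OF X U], drule loc, erule locally_mono) simp
  then show "plot (seq_diff X) n U p" by simp
qed (use X in \<open>auto intro: plot_openin plot_const plot_compose\<close>)

lemma diffeological_space_sub:
  assumes X: "diffeological_space X"
  shows "diffeological_space (sub_diff X A)"
proof (rule diffeological_spaceI)
  fix m V n U h p assume "plot (sub_diff X A) n U p" "smooth_map m V n U h"
  then show "plot (sub_diff X A) m V (\<lambda>v. p (h v))"
    using plot_compose[OF X] by (auto simp: smooth_map_def)
next
  fix n U p
  assume U: "openin (Euclidean_space n) U"
    and loc: "\<And>u. u \<in> U \<Longrightarrow> \<exists>V. openin (Euclidean_space n) V \<and> u \<in> V \<and> V \<subseteq> U \<and> plot (sub_diff X A) n V p"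
  have "plot X n U p" by (rule plot_local[OF X U], drule loc, erule locally_mono) simp
  moreover have "p u \<in> A" if "u \<in> U" for u using loc[OF that] by auto
  ultimately show "plot (sub_diff X A) n U p" by simp
next
  fix n U p q assume "plot (sub_diff X A) n U p" "\<And>u. u \<in> U \<Longrightarrow> q u = p u"
  then show "plot (sub_diff X A) n U q" using plot_cong[OF X, of n U p q] by simp
qed (use X in \<open>auto intro: plot_openin plot_in_pts plot_const\<close>)

lemma diffeological_space_quot:
  assumes X: "diffeological_space X"
  shows "diffeological_space (quot_diff X R)"
proof (rule diffeological_spaceI)
  fix n U p u assume p: "plot (quot_diff X R) n U p" "u \<in> U"
  then obtain V q where "u \<in> V" "plot X n V q" "\<forall>v\<in>V. p v = R `` {q v}"
    by (rule plot_quot_diffE)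
  then show "p u \<in> pts (quot_diff X R)" using plot_in_pts[OF X] by (auto intro: quotientI)
next
  fix n U x assume U: "openin (Euclidean_space n) U" and "x \<in> pts (quot_diff X R)"
  then obtain y where y: "y \<in> pts X" "x = R `` {y}" by (auto elim: quotientE)
  show "plot (quot_diff X R) n U (\<lambda>_. x)"
    unfolding plot_quot_diff using U y plot_const[OF X U y(1)] by auto
next
  fix m V n U h p assume p: "plot (quot_diff X R) n U p" and h: "smooth_map m V n U h"
  show "plot (quot_diff X R) m V (\<lambda>v. p (h v))"
    unfolding plot_quot_diff
  proof (intro conjI ballI)
    show "openin (Euclidean_space m) V" using h by (simp add: smooth_map_def)
    fix v assume v: "v \<in> V"
    then have "h v \<in> U" using h by (auto simp: smooth_map_def)
    with p obtain W q where W: "openin (Euclidean_space n) W" "h v \<in> W" "W \<subseteq> U" "plot X n W q"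
      "\<forall>w\<in>W. p w = R `` {q w}" by (rule plot_quot_diffE)
    let ?V = "{v \<in> V. h v \<in> W}"
    have V: "openin (Euclidean_space m) ?V" by (rule smooth_map_openin_preimage[OF h W(1)])
    have "smooth_map m ?V n W h"
      using h V W(1) by (auto simp: smooth_map_def intro: smooth_fun_subset)
    from plot_compose[OF X W(4) this]
    show "\<exists>V' q. openin (Euclidean_space m) V' \<and> v \<in> V' \<and> V' \<subseteq> V \<and> plot X m V' q \<and>
        (\<forall>v\<in>V'. p (h v) = R `` {q v})"
      using V v W(2,5) by (intro exI[of _ ?V] exI[of _ "\<lambda>v. q (h v)"]) auto
  qed
next
  fix n U p
  assume U: "openin (Euclidean_space n) U"
    and loc: "\<And>u. u \<in> U \<Longrightarrow> \<exists>V. openin (Euclidean_space n) V \<and> u \<in> V \<and> V \<subseteq> U \<and> plot (quot_diff X R) n V p"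
  show "plot (quot_diff X R) n U p"
    unfolding plot_quot_diff
  proof (intro conjI ballI)
    fix u assume "u \<in> U"
    then obtain V where V: "V \<subseteq> U" "u \<in> V" "plot (quot_diff X R) n V p" using loc by blast
    obtain W q where "openin (Euclidean_space n) W" "u \<in> W" "W \<subseteq> V" "plot X n W q"
      "\<forall>v\<in>W. p v = R `` {q v}"
      using plot_quot_diffE[OF V(3,2)] by blast
    with V(1) show "\<exists>V q. openin (Euclidean_space n) V \<and> u \<in> V \<and> V \<subseteq> U \<and> plot X n V q \<and>
        (\<forall>v\<in>V. p v = R `` {q v})" by (intro exI[of _ W] exI[of _ q]) auto
  qed (rule U)
next
  fix n U p q assume p: "plot (quot_diff X R) n U p" and q: "\<And>u. u \<in> U \<Longrightarrow> q u = p u"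
  show "plot (quot_diff X R) n U q"
    unfolding plot_quot_diff
  proof (intro conjI ballI)
    fix u assume "u \<in> U"
    with p obtain W r where "openin (Euclidean_space n) W" "u \<in> W" "W \<subseteq> U" "plot X n W r"
      "\<forall>v\<in>W. p v = R `` {r v}" by (rule plot_quot_diffE)
    with q show "\<exists>V r. openin (Euclidean_space n) V \<and> u \<in> V \<and> V \<subseteq> U \<and> plot X n V r \<and>
        (\<forall>v\<in>V. q v = R `` {r v})" by (intro exI[of _ W] exI[of _ r]) auto
  qed (use p plot_quot_diff in blast)
qed (simp add: plot_quot_diff)

lemma dsmooth_quotient_map:
  assumes "diffeological_space X"
  shows "dsmooth X (quot_diff X R) (\<lambda>x. R `` {x})"
  using plot_openin[OF assms] by (intro dsmoothI) (auto simp: plot_quot_diff intro: quotientI)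

lemma sub_diff_UNIV: "sub_diff X UNIV = X"
  by (cases X) (simp add: sub_diff_def)

text \<open>
  The universal property of a quotient, restricted to a part \<open>A\<close> of it: a function that is only
  meaningful on \<open>A\<close> is smooth there as soon as it is smooth on representatives.
\<close>
lemma dsmooth_sub_quot_diffI:
  assumes Y: "diffeological_space Y"
    and f: "\<And>x. x \<in> pts X \<Longrightarrow> R `` {x} \<in> A \<Longrightarrow> f (R `` {x}) = g x"
    and X: "diffeological_space X"
    and g: "dsmooth (sub_diff X {x. R `` {x} \<in> A}) Y g"
  shows "dsmooth (sub_diff (quot_diff X R) A) Y f"
proof (rule dsmoothI)
  fix c assume "c \<in> pts (sub_diff (quot_diff X R) A)"
  then obtain x where "x \<in> pts X" "c = R `` {x}" "R `` {x} \<in> A" by (auto elim: quotientE)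
  then show "f c \<in> pts Y" using f[of x] dsmooth_in_pts[OF g, of x] by simp
next
  fix n U p assume "plot (sub_diff (quot_diff X R) A) n U p"
  then have p: "plot (quot_diff X R) n U p" and pA: "\<And>u. u \<in> U \<Longrightarrow> p u \<in> A" by auto
  show "plot Y n U (\<lambda>u. f (p u))"
  proof (rule plot_local[OF Y])
    show "openin (Euclidean_space n) U" using p plot_quot_diff by blast
    fix u assume "u \<in> U"
    with p obtain V q where V: "openin (Euclidean_space n) V" "u \<in> V" "V \<subseteq> U" "plot X n V q"
      "\<forall>v\<in>V. p v = R `` {q v}" by (rule plot_quot_diffE)
    have qA: "R `` {q v} \<in> A" if "v \<in> V" for v using V(3) V(5)[rule_format, OF that] pA[of v] that by auto
    have "plot Y n V (\<lambda>v. g (q v))" by (rule dsmooth_plot[OF g]) (use V(4) qA in auto)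
    moreover have "f (p v) = g (q v)" if "v \<in> V" for v
      using V(5)[rule_format, OF that] f[OF plot_in_pts[OF X V(4) that] qA[OF that]] by simp
    ultimately have "plot Y n V (\<lambda>u. f (p u))" by (rule plot_cong[OF Y])
    then show "\<exists>V. openin (Euclidean_space n) V \<and> u \<in> V \<and> V \<subseteq> U \<and> plot Y n V (\<lambda>u. f (p u))"
      using V(1-3) by blast
  qed
qed

lemma dsmooth_quot_diffI:
  assumes "diffeological_space Y" "\<And>x. x \<in> pts X \<Longrightarrow> f (R `` {x}) = g x"
    "diffeological_space X" "dsmooth X Y g"
  shows "dsmooth (quot_diff X R) Y f"
  using dsmooth_sub_quot_diffI[of Y X R UNIV f g] assms
  by (simp add: sub_diff_UNIV)

section \<open>Bundles whose fibres are orbits\<close>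

lemma plot_group_mult:
  assumes "diffeological_group G D" "plot D n U p" "plot D n U q"
  shows "plot D n U (\<lambda>u. p u \<otimes>\<^bsub>G\<^esub> q u)"
  using assms dsmooth_plot[of "prod_diff D D" D _ n U "\<lambda>u. (p u, q u)"]
  by (force simp: diffeological_group_def)

lemma plot_group_inv:
  "diffeological_group G D \<Longrightarrow> plot D n U p \<Longrightarrow> plot D n U (\<lambda>u. inv\<^bsub>G\<^esub> p u)"
  by (auto simp: diffeological_group_def dest: dsmooth_plot)

lemma plot_right_action:
  assumes "smooth_right_action G D E act" "plot E n U p" "plot D n U q"
  shows "plot E n U (\<lambda>u. act (p u) (q u))"
  using assms dsmooth_plot[of "prod_diff E D" E _ n U "\<lambda>u. (p u, q u)"]
  by (force simp: smooth_right_action_def)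

lemma right_action_in_pts:
  assumes "smooth_right_action G D E act" "pts D = carrier G" "x \<in> pts E" "g \<in> carrier G"
  shows "act x g \<in> pts E"
  using assms dsmooth_in_pts[of "prod_diff E D" E _ "(x, g)"]
  by (force simp: smooth_right_action_def)

text \<open>
  Plots of the base lift locally, and the fibres are the orbits. Orbit spaces have these two
  properties, and both pass to restrictions and pullbacks; together they reduce triviality to the
  existence of an equivariant map to the group.
\<close>
definition orbit_bundle ::
    "('g, 'm) monoid_scheme \<Rightarrow> 'g diffeology \<Rightarrow> 'e diffeology \<Rightarrow> 'b diffeology \<Rightarrow>
     ('e \<Rightarrow> 'g \<Rightarrow> 'e) \<Rightarrow> ('e \<Rightarrow> 'b) \<Rightarrow> bool" where
  "orbit_bundle G D E B act \<pi> \<longleftrightarrow>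
     bundle_data G D E B act \<pi> \<and>
     (\<forall>n U p. plot B n U p \<longrightarrow>
       (\<forall>u\<in>U. \<exists>V q. openin (Euclidean_space n) V \<and> u \<in> V \<and> V \<subseteq> U \<and>
          plot E n V q \<and> (\<forall>v\<in>V. \<pi> (q v) = p v))) \<and>
     (\<forall>x\<in>pts E. \<forall>y\<in>pts E. \<pi> x = \<pi> y \<longrightarrow> (\<exists>g\<in>carrier G. y = act x g))"

lemma orbit_bundle_data: "orbit_bundle G D E B act \<pi> \<Longrightarrow> bundle_data G D E B act \<pi>"
  by (simp add: orbit_bundle_def)

lemma orbit_bundle_local_lift:
  assumes "orbit_bundle G D E B act \<pi>" "plot B n U p" "u \<in> U"
  obtains V q where "openin (Euclidean_space n) V" "u \<in> V" "V \<subseteq> U" "plot E n V q"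
    "\<forall>v\<in>V. \<pi> (q v) = p v"
proof -
  have "\<exists>V q. openin (Euclidean_space n) V \<and> u \<in> V \<and> V \<subseteq> U \<and> plot E n V q \<and> (\<forall>v\<in>V. \<pi> (q v) = p v)"
    using assms by (simp add: orbit_bundle_def)
  then obtain V q where "openin (Euclidean_space n) V \<and> u \<in> V \<and> V \<subseteq> U \<and> plot E n V q \<and> (\<forall>v\<in>V. \<pi> (q v) = p v)" by blast
  then show thesis by (intro that[of V q]) simp_all
qed

lemma orbit_bundle_transitive:
  assumes "orbit_bundle G D E B act \<pi>" "x \<in> pts E" "y \<in> pts E" "\<pi> x = \<pi> y"
  obtains g where "g \<in> carrier G" "y = act x g"
  using assms unfolding orbit_bundle_def by blast

text \<open>
  A point is a plot of dimension \<open>0\<close>, so lifting plots includes lifting points.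
\<close>
lemma orbit_bundle_surj:
  assumes E: "orbit_bundle G D E B act \<pi>" and b: "b \<in> pts B"
  obtains x where "x \<in> pts E" "\<pi> x = b"
proof -
  let ?U = "topspace (Euclidean_space 0)"
  have dE: "diffeological_space E" and dB: "diffeological_space B"
    using orbit_bundle_data[OF E] by (auto simp: bundle_data_def)
  have "plot B 0 ?U (\<lambda>_. b)" by (rule plot_const[OF dB openin_topspace b])
  moreover have "(\<lambda>_. 0) \<in> ?U" by (simp add: topspace_Euclidean_space)
  ultimately obtain V q where "(\<lambda>_. 0) \<in> V" "plot E 0 V q" "\<forall>v\<in>V. \<pi> (q v) = b"
    using orbit_bundle_local_lift[OF E, of 0 ?U "\<lambda>_. b"] by metis
  then show thesis using plot_in_pts[OF dE] that by blast
qed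

text \<open>
  The trivialisation is \<open>x \<mapsto> (\<pi> x, \<tau> x)\<close>. Its inverse sends \<open>(b, g)\<close> to \<open>x \<cdot> (\<tau> x)\<^sup>-\<^sup>1 g\<close>, where \<open>x\<close> is any
  point over \<open>b\<close>; this is smooth because \<open>x\<close> can locally be chosen along a lift of the plot of the base.
\<close>
lemma trivial_principal_bundle_if_equivariant:
  assumes E: "orbit_bundle G D E B act \<pi>"
    and \<tau>: "dsmooth E D \<tau>"
    and \<tau>_act: "\<And>x g. x \<in> pts E \<Longrightarrow> g \<in> carrier G \<Longrightarrow> \<tau> (act x g) = \<tau> x \<otimes>\<^bsub>G\<^esub> g"
  shows "trivial_principal_bundle G D E B act \<pi>"
proof -
  have data: "bundle_data G D E B act \<pi>" by (rule orbit_bundle_data[OF E])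
  then have dG: "diffeological_group G D" and dE: "diffeological_space E" and dB: "diffeological_space B"
    and \<pi>: "dsmooth E B \<pi>" and act: "smooth_right_action G D E act"
    and \<pi>_act: "\<And>x g. x \<in> pts E \<Longrightarrow> g \<in> carrier G \<Longrightarrow> \<pi> (act x g) = \<pi> x"
    by (auto simp: bundle_data_def)
  from dG have "group G" and ptsD: "pts D = carrier G" by (auto simp: diffeological_group_def)
  interpret group G by fact
  have act_one: "act x \<one>\<^bsub>G\<^esub> = x" if "x \<in> pts E" for x
    using act that by (auto simp: smooth_right_action_def)
  have act_act: "act (act x g) h = act x (g \<otimes>\<^bsub>G\<^esub> h)" if "x \<in> pts E" "g \<in> carrier G" "h \<in> carrier G" for x g h
    using act that by (auto simp: smooth_right_action_def)
  note act_pts = right_action_in_pts[OF act ptsD]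
  have \<tau>_G: "\<tau> x \<in> carrier G" if "x \<in> pts E" for x
    using dsmooth_in_pts[OF \<tau> that] ptsD by simp
  let ?c = "\<lambda>x g. act x (inv\<^bsub>G\<^esub> \<tau> x \<otimes>\<^bsub>G\<^esub> g)"
  define \<psi> where "\<psi> = (\<lambda>(b, g). ?c (SOME x. x \<in> pts E \<and> \<pi> x = b) g)"
  \<comment> \<open>The point \<open>?c x g\<close> is the one of value \<open>g\<close> under \<open>\<tau>\<close> in the orbit of \<open>x\<close>, so it does not
    depend on the representative of the orbit.\<close>
  have \<psi>: "\<psi> (\<pi> x, g) = ?c x g" if x: "x \<in> pts E" and g: "g \<in> carrier G" for x g
  proof -
    define y where "y = (SOME y. y \<in> pts E \<and> \<pi> y = \<pi> x)"
    have y: "y \<in> pts E \<and> \<pi> y = \<pi> x"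
      unfolding y_def by (rule someI[of _ x]) (use x in simp)
    then obtain h where h: "h \<in> carrier G" "y = act x h"
      using orbit_bundle_transitive[OF E x, of y] by metis
    have "?c y g = act x (h \<otimes>\<^bsub>G\<^esub> (inv\<^bsub>G\<^esub> (\<tau> x \<otimes>\<^bsub>G\<^esub> h) \<otimes>\<^bsub>G\<^esub> g))"
      using x g h \<tau>_G by (simp add: \<tau>_act act_act)
    also have "h \<otimes>\<^bsub>G\<^esub> (inv\<^bsub>G\<^esub> (\<tau> x \<otimes>\<^bsub>G\<^esub> h) \<otimes>\<^bsub>G\<^esub> g) = inv\<^bsub>G\<^esub> \<tau> x \<otimes>\<^bsub>G\<^esub> g"
      using h g \<tau>_G[OF x] by (simp add: inv_mult_group m_assoc[symmetric])
    finally show ?thesis by (simp add: \<psi>_def y_def)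
  qed
  have "dsmooth (prod_diff B D) E \<psi>"
  proof (rule dsmoothI)
    fix y assume "y \<in> pts (prod_diff B D)"
    then obtain b g where bg: "y = (b, g)" "b \<in> pts B" "g \<in> carrier G" using ptsD by auto
    then obtain x where "x \<in> pts E" "\<pi> x = b" using orbit_bundle_surj[OF E] by blast
    then show "\<psi> y \<in> pts E" using bg \<psi>[of x g] act_pts \<tau>_G by auto
  next
    fix n U p assume "plot (prod_diff B D) n U p"
    then have p1: "plot B n U (\<lambda>u. fst (p u))" and p2: "plot D n U (\<lambda>u. snd (p u))" by auto
    show "plot E n U (\<lambda>u. \<psi> (p u))"
    proof (rule plot_local[OF dE plot_openin[OF dB p1]])
      fix u assume "u \<in> U"
      with E p1 obtain V q where V: "openin (Euclidean_space n) V" "u \<in> V" "V \<subseteq> U" and q: "plot E n V q"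
        "\<forall>v\<in>V. \<pi> (q v) = fst (p v)"
        by (rule orbit_bundle_local_lift)
      have dD: "diffeological_space D" using dG by (simp add: diffeological_group_def)
      have p2V: "plot D n V (\<lambda>u. snd (p u))" by (rule plot_subset[OF dD p2 V(1,3)])
      have "plot E n V (\<lambda>v. ?c (q v) (snd (p v)))"
        using plot_right_action[OF act q(1) plot_group_mult[OF dG plot_group_inv[OF dG dsmooth_plot[OF \<tau> q(1)]] p2V]] .
      moreover have "\<psi> (p v) = ?c (q v) (snd (p v))" if "v \<in> V" for v
        using \<psi>[of "q v" "snd (p v)"] q(2)[rule_format, OF that] plot_in_pts[OF dE q(1) that]
          plot_in_pts[OF dD p2V that] ptsD by simp
      ultimately have "plot E n V (\<lambda>u. \<psi> (p u))" by (rule plot_cong[OF dE])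
      then show "\<exists>V. openin (Euclidean_space n) V \<and> u \<in> V \<and> V \<subseteq> U \<and> plot E n V (\<lambda>u. \<psi> (p u))"
        using V by blast
    qed
  qed
  moreover have "\<psi> (\<pi> x, \<tau> x) = x" if "x \<in> pts E" for x
    using that \<psi>[OF that \<tau>_G[OF that]] \<tau>_G[OF that] act_one by simp
  moreover have "(\<pi> (\<psi> y), \<tau> (\<psi> y)) = y" if "y \<in> pts (prod_diff B D)" for y
  proof -
    obtain b g where bg: "y = (b, g)" "b \<in> pts B" "g \<in> carrier G" using \<open>y \<in> _\<close> ptsD by auto
    then obtain x where x: "x \<in> pts E" "\<pi> x = b" using orbit_bundle_surj[OF E] by blast
    have "\<tau> x \<otimes>\<^bsub>G\<^esub> (inv\<^bsub>G\<^esub> \<tau> x \<otimes>\<^bsub>G\<^esub> g) = g"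
      using bg \<tau>_G[OF x(1)] by (simp add: m_assoc[symmetric])
    then show ?thesis using bg x \<psi>[OF x(1) bg(3)] \<pi>_act \<tau>_act \<tau>_G by auto
  qed
  moreover have "dsmooth E (prod_diff B D) (\<lambda>x. (\<pi> x, \<tau> x))"
    using \<pi> \<tau> by (intro dsmoothI) (auto intro: dsmooth_in_pts dsmooth_plot)
  ultimately have "diffeomorphism E (prod_diff B D) (\<lambda>x. (\<pi> x, \<tau> x))"
    unfolding diffeomorphism_def by blast
  then show ?thesis
    unfolding trivial_principal_bundle_def using data \<pi>_act \<tau>_act
    by (intro conjI exI[of _ "\<lambda>x. (\<pi> x, \<tau> x)"]) auto
qed

lemma orbit_bundle_restrict:
  assumes E: "orbit_bundle G D E B act \<pi>"
  shows "orbit_bundle G D (sub_diff E {x \<in> pts E. \<pi> x \<in> A}) (sub_diff B A) act \<pi>"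
proof -
  have dG: "diffeological_group G D" and dE: "diffeological_space E" and dB: "diffeological_space B"
    and \<pi>: "dsmooth E B \<pi>" and act: "smooth_right_action G D E act"
    and \<pi>_act: "\<And>x g. x \<in> pts E \<Longrightarrow> g \<in> carrier G \<Longrightarrow> \<pi> (act x g) = \<pi> x"
    using orbit_bundle_data[OF E] by (auto simp: bundle_data_def)
  have ptsD: "pts D = carrier G" and dD: "diffeological_space D"
    using dG by (auto simp: diffeological_group_def)
  let ?E = "sub_diff E {x \<in> pts E. \<pi> x \<in> A}"
  have "dsmooth ?E (sub_diff B A) \<pi>"
    using \<pi> by (intro dsmoothI) (auto intro: dsmooth_in_pts dsmooth_plot)
  moreover have "dsmooth (prod_diff ?E D) ?E (\<lambda>(x, g). act x g)"
  proof (rule dsmoothI)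
    fix y assume "y \<in> pts (prod_diff ?E D)"
    then show "(case y of (x, g) \<Rightarrow> act x g) \<in> pts ?E"
      using right_action_in_pts[OF act ptsD] \<pi>_act ptsD by auto
  next
    fix n U p assume p: "plot (prod_diff ?E D) n U p"
    then have "plot E n U (\<lambda>u. act (fst (p u)) (snd (p u)))"
      by (intro plot_right_action[OF act]) auto
    moreover have "snd (p u) \<in> carrier G" if "u \<in> U" for u
      using p plot_in_pts[OF dD _ that, of n "\<lambda>u. snd (p u)"] ptsD by simp
    ultimately show "plot ?E n U (\<lambda>u. case p u of (x, g) \<Rightarrow> act x g)"
      using p right_action_in_pts[OF act ptsD] \<pi>_act by (auto simp: split_beta)
  qed
  ultimately have data: "bundle_data G D ?E (sub_diff B A) act \<pi>"
    using dG act \<pi>_act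
    by (auto simp: bundle_data_def smooth_right_action_def diffeological_space_sub dE dB)
  have lift: "\<exists>V q. openin (Euclidean_space n) V \<and> u \<in> V \<and> V \<subseteq> U \<and> plot ?E n V q \<and> (\<forall>v\<in>V. \<pi> (q v) = p v)"
    if p: "plot (sub_diff B A) n U p" and u: "u \<in> U" for n U p u
  proof -
    have pB: "plot B n U p" and pA: "\<And>u. u \<in> U \<Longrightarrow> p u \<in> A" using p by auto
    obtain V q where V: "openin (Euclidean_space n) V" "u \<in> V" "V \<subseteq> U" "plot E n V q"
      "\<forall>v\<in>V. \<pi> (q v) = p v" by (rule orbit_bundle_local_lift[OF E pB u])
    have "plot ?E n V q" using V pA plot_in_pts[OF dE V(4)] by auto
    with V show ?thesis by blast
  qed
  show ?thesis
    unfolding orbit_bundle_def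
  proof (intro conjI allI impI ballI)
    show "bundle_data G D ?E (sub_diff B A) act \<pi>" by fact
  next
    fix n U p u assume "plot (sub_diff B A) n U p" "u \<in> U"
    then show "\<exists>V q. openin (Euclidean_space n) V \<and> u \<in> V \<and> V \<subseteq> U \<and> plot ?E n V q \<and> (\<forall>v\<in>V. \<pi> (q v) = p v)"
      by (rule lift)
  next
    fix x y assume "x \<in> pts ?E" "y \<in> pts ?E" "\<pi> x = \<pi> y"
    then show "\<exists>g\<in>carrier G. y = act x g"
      using orbit_bundle_transitive[OF E, of x y] by auto
  qed
qed

lemma orbit_bundle_pullback:
  assumes E: "orbit_bundle G D E B act \<pi>" and f: "dsmooth C B f" and dC: "diffeological_space C"
  shows "orbit_bundle G D (pullback_diff C E f \<pi>) C (\<lambda>(u, x) g. (u, act x g)) fst"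
proof -
  have dG: "diffeological_group G D" and dE: "diffeological_space E" and dB: "diffeological_space B"
    and \<pi>: "dsmooth E B \<pi>" and act: "smooth_right_action G D E act"
    and \<pi>_act: "\<And>x g. x \<in> pts E \<Longrightarrow> g \<in> carrier G \<Longrightarrow> \<pi> (act x g) = \<pi> x"
    using orbit_bundle_data[OF E] by (auto simp: bundle_data_def)
  have ptsD: "pts D = carrier G" and dD: "diffeological_space D"
    using dG by (auto simp: diffeological_group_def)
  let ?E = "pullback_diff C E f \<pi>" and ?act = "\<lambda>(u, x) g. (u, act x g)"
  have pts: "pts ?E = {(c, x). c \<in> pts C \<and> x \<in> pts E \<and> f c = \<pi> x}"
    by (auto simp: pullback_diff_def)
  have plot: "plot ?E n U p \<longleftrightarrow> plot C n U (\<lambda>u. fst (p u)) \<and> plot E n U (\<lambda>u. snd (p u)) \<and>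
      (\<forall>u\<in>U. f (fst (p u)) = \<pi> (snd (p u)))" for n U p
    using plot_in_pts[OF dC, of n U "\<lambda>u. fst (p u)"] plot_in_pts[OF dE, of n U "\<lambda>u. snd (p u)"]
    by (auto simp: pullback_diff_def split_beta)
  have d: "diffeological_space ?E"
    unfolding pullback_diff_def by (intro diffeological_space_sub diffeological_space_prod dC dE)
  have "dsmooth ?E C fst" by (intro dsmoothI) (auto simp: pts plot)
  moreover have "dsmooth (prod_diff ?E D) ?E (\<lambda>(y, g). ?act y g)"
  proof (rule dsmoothI)
    fix y assume "y \<in> pts (prod_diff ?E D)"
    then show "(case y of (y, g) \<Rightarrow> ?act y g) \<in> pts ?E"
      using right_action_in_pts[OF act ptsD] \<pi>_act ptsD by (auto simp: pts)
  next
    fix n U p assume "plot (prod_diff ?E D) n U p"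
    then have p: "plot C n U (\<lambda>u. fst (fst (p u)))" "plot E n U (\<lambda>u. snd (fst (p u)))"
      "plot D n U (\<lambda>u. snd (p u))" "\<And>u. u \<in> U \<Longrightarrow> f (fst (fst (p u))) = \<pi> (snd (fst (p u)))"
      by (auto simp: plot)
    then have "plot E n U (\<lambda>u. act (snd (fst (p u))) (snd (p u)))"
      by (intro plot_right_action[OF act])
    moreover have "\<pi> (act (snd (fst (p u))) (snd (p u))) = \<pi> (snd (fst (p u)))" if "u \<in> U" for u
      using \<pi>_act plot_in_pts[OF dD p(3) that] plot_in_pts[OF dE p(2) that] ptsD by simp
    ultimately show "plot ?E n U (\<lambda>u. case p u of (y, g) \<Rightarrow> ?act y g)"
      using p by (simp add: plot split_beta)
  qed
  ultimately have data: "bundle_data G D ?E C ?act fst"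
    using dG act by (auto simp: bundle_data_def smooth_right_action_def d dC pts)
  show ?thesis
    unfolding orbit_bundle_def
  proof (intro conjI allI impI ballI)
    show "bundle_data G D ?E C ?act fst" by fact
  next
    fix n U p u assume p: "plot C n U p" and u: "u \<in> U"
    obtain V q where V: "openin (Euclidean_space n) V" "u \<in> V" "V \<subseteq> U" "plot E n V q"
      "\<forall>v\<in>V. \<pi> (q v) = f (p v)"
      using orbit_bundle_local_lift[OF E dsmooth_plot[OF f p] u] by blast
    have "plot ?E n V (\<lambda>v. (p v, q v))"
      using V plot_subset[OF dC p V(1,3)] by (simp add: plot)
    with V show "\<exists>V q. openin (Euclidean_space n) V \<and> u \<in> V \<and> V \<subseteq> U \<and> plot ?E n V q \<and> (\<forall>v\<in>V. fst (q v) = p v)"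
      by (intro exI[of _ V] exI[of _ "\<lambda>v. (p v, q v)"]) simp
  next
    fix x y assume "x \<in> pts ?E" "y \<in> pts ?E" "fst x = fst y"
    then show "\<exists>g\<in>carrier G. y = ?act x g"
      using orbit_bundle_transitive[OF E, of "snd x" "snd y"] by (auto simp: pts) metis
  qed
qed

lemma orbit_bundle_trivial_over:
  assumes "orbit_bundle G D E B act \<pi>"
    and "dsmooth (sub_diff E {x \<in> pts E. \<pi> x \<in> A}) D \<tau>"
    and "\<And>x g. x \<in> pts E \<Longrightarrow> \<pi> x \<in> A \<Longrightarrow> g \<in> carrier G \<Longrightarrow> \<tau> (act x g) = \<tau> x \<otimes>\<^bsub>G\<^esub> g"
  shows "trivial_over G D E B act \<pi> A"
  unfolding trivial_over_def
  by (rule trivial_principal_bundle_if_equivariant[OF orbit_bundle_restrict[OF assms(1)] assms(2)])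
    (use assms(3) in auto)

text \<open>
  The equivariant maps that trivialise the bundle over a D-open cover of \<open>B\<close> also trivialise each
  pullback, over the preimages of the covering sets.
\<close>
lemma orbit_bundle_principal:
  assumes E: "orbit_bundle G D E B act \<pi>"
    and cover: "\<And>A. A \<in> \<U> \<Longrightarrow> D_open B A" "\<Union>\<U> = pts B"
    and \<tau>: "\<And>A. A \<in> \<U> \<Longrightarrow> dsmooth (sub_diff E {x \<in> pts E. \<pi> x \<in> A}) D (\<tau> A)"
    and \<tau>_act: "\<And>A x g. A \<in> \<U> \<Longrightarrow> x \<in> pts E \<Longrightarrow> \<pi> x \<in> A \<Longrightarrow> g \<in> carrier G \<Longrightarrow> \<tau> A (act x g) = \<tau> A x \<otimes>\<^bsub>G\<^esub> g"
  shows "principal_bundle G D E B act \<pi>"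
  unfolding principal_bundle_def
proof (intro conjI allI impI)
  show "bundle_data G D E B act \<pi>" by (rule orbit_bundle_data[OF E])
  then have dE: "diffeological_space E" and dB: "diffeological_space B" by (auto simp: bundle_data_def)
  fix n U p assume p: "plot B n U p"
  let ?C = "euclid_diff n U" and ?act = "\<lambda>(u, x) g. (u, act x g)"
  let ?E = "pullback_diff ?C E p \<pi>"
  have dC: "diffeological_space ?C" by (rule diffeological_space_euclid[OF plot_openin[OF dB p]])
  have ps: "dsmooth ?C B p"
    using plot_in_pts[OF dB p] plot_compose[OF dB p] by (intro dsmoothI) auto
  note E' = orbit_bundle_pullback[OF E ps dC]
  show "locally_trivial_principal_bundle G D ?E ?C ?act fst"
    unfolding locally_trivial_principal_bundle_def
  proof (intro conjI exI[of _ "(\<lambda>A. {u \<in> U. p u \<in> A}) ` \<U>"] ballI)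
    show "bundle_data G D ?E ?C ?act fst" by (rule orbit_bundle_data[OF E'])
  next
    fix W assume "W \<in> (\<lambda>A. {u \<in> U. p u \<in> A}) ` \<U>"
    then obtain A where A: "A \<in> \<U>" "W = {u \<in> U. p u \<in> A}" by blast
    have "openin (Euclidean_space m) {v \<in> V. h v \<in> W}" if h: "smooth_map m V n U h" for m V h
    proof -
      have "{v \<in> V. h v \<in> W} = {v \<in> V. p (h v) \<in> A}" using h A(2) by (auto simp: smooth_map_def)
      with cover(1)[OF A(1)] plot_compose[OF dB p h] show ?thesis by (simp add: D_open_def)
    qed
    then show "D_open ?C W" using A(2) by (auto simp: D_open_def)
    show "trivial_over G D ?E ?C ?act fst W"
    proof (rule orbit_bundle_trivial_over[OF E', where \<tau> = "\<lambda>y. \<tau> A (snd y)"])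
      have "dsmooth (sub_diff ?E {y \<in> pts ?E. fst y \<in> W}) (sub_diff E {x \<in> pts E. \<pi> x \<in> A}) snd"
        by (rule dsmoothI) (auto simp: pullback_diff_def A(2))
      then show "dsmooth (sub_diff ?E {y \<in> pts ?E. fst y \<in> W}) D (\<lambda>y. \<tau> A (snd y))"
        by (rule dsmooth_compose[OF \<tau>[OF A(1)]])
    qed (auto simp: pullback_diff_def A(2) intro: \<tau>_act[OF A(1)])
  next
    show "\<Union> ((\<lambda>A. {u \<in> U. p u \<in> A}) ` \<U>) = pts ?C"
      using cover(2) plot_in_pts[OF dB p] by auto
  qed
qed

lemma orbit_bundle_orbit_space:
  assumes dG: "diffeological_group G D" and dE: "diffeological_space E"
    and act: "smooth_right_action G D E act"
  defines "R \<equiv> orbit_rel G E act"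
  shows "orbit_bundle G D E (quot_diff E R) act (\<lambda>x. R `` {x})"
proof -
  have "group G" and ptsD: "pts D = carrier G" using dG by (auto simp: diffeological_group_def)
  interpret group G by fact
  have act_one: "act x \<one>\<^bsub>G\<^esub> = x" if "x \<in> pts E" for x
    using act that by (auto simp: smooth_right_action_def)
  have act_act: "act (act x g) h = act x (g \<otimes>\<^bsub>G\<^esub> h)" if "x \<in> pts E" "g \<in> carrier G" "h \<in> carrier G" for x g h
    using act that by (auto simp: smooth_right_action_def)
  note act_pts = right_action_in_pts[OF act ptsD]
  have R: "R `` {x} = act x ` carrier G" if "x \<in> pts E" for x
    using that by (auto simp: R_def orbit_rel_def)
  have inv: "R `` {act x g} = R `` {x}" if x: "x \<in> pts E" and g: "g \<in> carrier G" for x g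
  proof -
    have "act x h \<in> act (act x g) ` carrier G" if h: "h \<in> carrier G" for h
    proof (rule image_eqI[where x = "inv\<^bsub>G\<^esub> g \<otimes>\<^bsub>G\<^esub> h"])
      show "act x h = act (act x g) (inv\<^bsub>G\<^esub> g \<otimes>\<^bsub>G\<^esub> h)"
        using x g h by (simp add: act_act m_assoc[symmetric])
    qed (use g h in simp)
    then show ?thesis using x g by (auto simp: R act_pts act_act)
  qed
  show ?thesis
    unfolding orbit_bundle_def
  proof (intro conjI allI impI ballI)
    show "bundle_data G D E (quot_diff E R) act (\<lambda>x. R `` {x})"
      unfolding bundle_data_def
      using dG dE act inv by (auto simp: diffeological_space_quot dsmooth_quotient_map)
  next
    fix n U p u assume "plot (quot_diff E R) n U p" "u \<in> U"
    then show "\<exists>V q. openin (Euclidean_space n) V \<and> u \<in> V \<and> V \<subseteq> U \<and> plot E n V q \<and> (\<forall>v\<in>V. R `` {q v} = p v)"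
      unfolding plot_quot_diff by metis
  next
    fix x y assume x: "x \<in> pts E" and y: "y \<in> pts E" and "R `` {x} = R `` {y}"
    moreover have "y \<in> R `` {y}" using R[OF y] act_one[OF y] by (metis imageI one_closed)
    ultimately show "\<exists>g\<in>carrier G. y = act x g" using R[OF x] by auto
  qed
qed

section \<open>D-open sets and supports\<close>

lemma D_open_preimage_real:
  assumes X: "diffeological_space X" and f: "dsmooth X real_diff f" and S: "open S"
  shows "D_open X {x \<in> pts X. f x \<in> S}"
  unfolding D_open_def
proof (intro conjI allI impI)
  fix n U p assume p: "plot X n U p"
  have "openin (Euclidean_space n) {u \<in> U. f (p u) \<in> S}"
    using dsmooth_plot[OF f p] S by (intro smooth_fun_openin_preimage) auto
  moreover have "p u \<in> pts X" if "u \<in> U" for u by (rule plot_in_pts[OF X p that])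
  ultimately show "openin (Euclidean_space n) {u \<in> U. p u \<in> {x \<in> pts X. f x \<in> S}}"
    by (simp cong: conj_cong)
qed auto

text \<open>
  D-closures are hard to compute, but a set given by a smooth weak inequality is D-closed and thus
  contains the support as soon as it contains the points where \<open>\<mu>\<close> is positive.
\<close>
lemma D_supp_subset_nonneg:
  assumes X: "diffeological_space X" and f: "dsmooth X real_diff f"
    and pos: "\<And>x. x \<in> pts X \<Longrightarrow> \<mu> x > 0 \<Longrightarrow> f x \<ge> 0"
  shows "D_supp X \<mu> \<subseteq> {x \<in> pts X. f x \<ge> 0}"
  unfolding D_supp_def
proof (rule closure_of_minimal)
  have "D_open X (pts X)" using D_open_preimage_real[OF X f open_UNIV] by simp
  then have "pts X \<subseteq> topspace (D_topology X)" by (simp add: openin_D_topology openin_subset)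
  moreover have "topspace (D_topology X) \<subseteq> pts X"
    by (metis D_open_def openin_D_topology openin_topspace)
  ultimately have top: "topspace (D_topology X) = pts X" by blast
  have "openin (D_topology X) {x \<in> pts X. f x \<in> {..<0}}"
    using D_open_preimage_real[OF X f open_lessThan] by (simp add: openin_D_topology)
  moreover have "topspace (D_topology X) - {x \<in> pts X. f x \<ge> 0} = {x \<in> pts X. f x \<in> {..<0}}"
    by (auto simp: top)
  ultimately show "closedin (D_topology X) {x \<in> pts X. f x \<ge> 0}"
    by (simp add: closedin_def top)
qed (use pos in auto)

section \<open>A partition of unity on the simplex\<close>

lemma pts_simplex_diff:
  "pts simplex_diff = {t. finite {i. t i \<noteq> 0} \<and> (\<Sum>i | t i \<noteq> 0. t i) = 1 \<and> (\<forall>i. t i \<ge> 0)}"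
  by (simp add: simplex_diff_def Let_def)

lemma plot_simplex_diff:
  "plot simplex_diff n U t \<longleftrightarrow> openin (Euclidean_space n) U \<and> (\<forall>u\<in>U. t u \<in> pts simplex_diff) \<and>
    (\<forall>i. smooth_fun n U (\<lambda>u. t u i)) \<and>
    (\<forall>u\<in>U. \<exists>V. openin (Euclidean_space n) V \<and> u \<in> V \<and> V \<subseteq> U \<and> (\<exists>N. \<forall>v\<in>V. \<forall>i>N. t v i = 0))"
  by (simp add: simplex_diff_def Let_def Pi_iff)

lemma plot_simplex_coordinate: "plot simplex_diff n U t \<Longrightarrow> smooth_fun n U (\<lambda>u. t u i)"
  by (simp add: plot_simplex_diff)

lemma plot_simplex_finiteE:
  assumes "plot simplex_diff n U t" "u \<in> U"
  obtains V N where "openin (Euclidean_space n) V" "u \<in> V" "V \<subseteq> U" "\<forall>v\<in>V. \<forall>i>N. t v i = 0"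
proof -
  have "\<exists>V. openin (Euclidean_space n) V \<and> u \<in> V \<and> V \<subseteq> U \<and> (\<exists>N. \<forall>v\<in>V. \<forall>i>N. t v i = 0)"
    using assms by (simp add: plot_simplex_diff)
  then obtain V N where "openin (Euclidean_space n) V \<and> u \<in> V \<and> V \<subseteq> U \<and> (\<forall>v\<in>V. \<forall>i>N. t v i = 0)"
    by blast
  then show thesis by (intro that[of V N]) simp_all
qed

lemma diffeological_space_simplex: "diffeological_space simplex_diff"
proof (rule diffeological_spaceI)
  fix n U p q assume p: "plot simplex_diff n U p" and q: "\<And>u. u \<in> U \<Longrightarrow> q u = p u"
  have "smooth_fun n U (\<lambda>u. q u i)" for i
    using smooth_fun_cong[OF plot_simplex_coordinate[OF p, of i], of "\<lambda>u. q u i"] q by simp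
  moreover have "\<exists>V. openin (Euclidean_space n) V \<and> u \<in> V \<and> V \<subseteq> U \<and> (\<exists>N. \<forall>v\<in>V. \<forall>i>N. q v i = 0)"
    if u: "u \<in> U" for u
  proof -
    obtain V N where V: "openin (Euclidean_space n) V" "u \<in> V" "V \<subseteq> U" "\<forall>v\<in>V. \<forall>i>N. p v i = 0"
      by (rule plot_simplex_finiteE[OF p u])
    then have "\<forall>v\<in>V. \<forall>i>N. q v i = 0" using q by (simp add: subset_iff)
    with V show ?thesis by blast
  qed
  ultimately show "plot simplex_diff n U q" using p q by (simp add: plot_simplex_diff)
next
  fix n U t assume U: "openin (Euclidean_space n) U" and t: "t \<in> pts simplex_diff"
  then have "finite {i. t i \<noteq> 0}" by (simp add: pts_simplex_diff)
  then obtain N where "\<forall>i\<in>{i. t i \<noteq> 0}. i \<le> N" using finite_nat_set_iff_bounded_le by blast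
  then have "\<forall>i>N. t i = 0" by force
  then show "plot simplex_diff n U (\<lambda>_. t)"
    using U t by (auto simp: plot_simplex_diff intro: smooth_fun_const)
next
  fix m V n U h p assume p: "plot simplex_diff n U p" and h: "smooth_map m V n U h"
  then have hU: "h v \<in> U" if "v \<in> V" for v using that by (auto simp: smooth_map_def)
  have V: "openin (Euclidean_space m) V" using h by (simp add: smooth_map_def)
  have "smooth_fun m V (\<lambda>v. p (h v) i)" for i
    by (rule smooth_fun_compose_smooth_map[OF plot_simplex_coordinate[OF p] h])
  moreover have "\<exists>W. openin (Euclidean_space m) W \<and> v \<in> W \<and> W \<subseteq> V \<and> (\<exists>N. \<forall>w\<in>W. \<forall>i>N. p (h w) i = 0)"
    if v: "v \<in> V" for v
  proof -
    obtain W N where W: "openin (Euclidean_space n) W" "h v \<in> W" "W \<subseteq> U" "\<forall>w\<in>W. \<forall>i>N. p w i = 0"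
      by (rule plot_simplex_finiteE[OF p hU[OF v]])
    have "\<forall>w\<in>{v \<in> V. h v \<in> W}. \<forall>i>N. p (h w) i = 0" using W(4) by simp
    with smooth_map_openin_preimage[OF h W(1)] v W(2) show ?thesis by blast
  qed
  ultimately show "plot simplex_diff m V (\<lambda>v. p (h v))"
    using V hU p by (simp add: plot_simplex_diff)
next
  fix n U p
  assume U: "openin (Euclidean_space n) U"
    and loc: "\<And>u. u \<in> U \<Longrightarrow> \<exists>V. openin (Euclidean_space n) V \<and> u \<in> V \<and> V \<subseteq> U \<and> plot simplex_diff n V p"
  have "smooth_fun n U (\<lambda>u. p u i)" for i
    by (rule smooth_fun_local[OF U], drule loc, erule locally_mono) (simp add: plot_simplex_diff)
  moreover have "p u \<in> pts simplex_diff" if "u \<in> U" for u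
    using loc[OF that] by (auto simp: plot_simplex_diff)
  moreover have "\<exists>V. openin (Euclidean_space n) V \<and> u \<in> V \<and> V \<subseteq> U \<and> (\<exists>N. \<forall>v\<in>V. \<forall>i>N. p v i = 0)"
    if u: "u \<in> U" for u
  proof -
    from loc[OF u] obtain V where V: "u \<in> V" "V \<subseteq> U" "plot simplex_diff n V p" by blast
    obtain W N where "openin (Euclidean_space n) W" "u \<in> W" "W \<subseteq> V" "\<forall>v\<in>W. \<forall>i>N. p v i = 0"
      by (rule plot_simplex_finiteE[OF V(3,1)])
    with V(2) show ?thesis by (meson subset_trans)
  qed
  ultimately show "plot simplex_diff n U p" using U by (simp add: plot_simplex_diff)
qed (auto simp: plot_simplex_diff)

text \<open>
  The set of summation depends on the point, but along a plot of the simplex it is locally contained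
  in a fixed finite set of indices, and the additional terms vanish.
\<close>
lemma smooth_fun_sum_over_support:
  assumes t: "plot simplex_diff n U t" and f: "\<And>k. smooth_fun n U (f k)"
    and f0: "\<And>k u. u \<in> U \<Longrightarrow> t u k = 0 \<Longrightarrow> f k u = 0"
  shows "smooth_fun n U (\<lambda>u. \<Sum>k | t u k \<noteq> 0. f k u)"
proof (rule smooth_fun_local)
  show "openin (Euclidean_space n) U" using t by (simp add: plot_simplex_diff)
  fix u assume u: "u \<in> U"
  obtain V N where V: "openin (Euclidean_space n) V" "u \<in> V" "V \<subseteq> U"
    and N: "\<forall>v\<in>V. \<forall>i>N. t v i = 0"
    by (rule plot_simplex_finiteE[OF t u])
  have "smooth_fun n V (\<lambda>v. \<Sum>k\<le>N. f k v)"
    by (intro smooth_fun_sum smooth_fun_subset[OF f] V)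
  moreover have "(\<Sum>k | t v k \<noteq> 0. f k v) = (\<Sum>k\<le>N. f k v)" if "v \<in> V" for v
    by (rule sum.mono_neutral_left) (use N that V(3) in \<open>auto intro!: f0 simp: not_less[symmetric]\<close>)
  ultimately have "smooth_fun n V (\<lambda>v. \<Sum>k | t v k \<noteq> 0. f k v)" by (rule smooth_fun_cong)
  with V show "\<exists>V. openin (Euclidean_space n) V \<and> u \<in> V \<and> V \<subseteq> U \<and> smooth_fun n V (\<lambda>u. \<Sum>k | t u k \<noteq> 0. f k u)"
    by blast
qed

definition simplex_sum_sq :: "(nat \<Rightarrow> real) \<Rightarrow> real" where
  "simplex_sum_sq t = (\<Sum>k | t k \<noteq> 0. (t k)\<^sup>2)"

text \<open>
  Every D-neighbourhood of every point of the simplex meets all of the sets \<open>{t\<^sub>n > 0}\<close>, and points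
  with \<open>t\<^sub>n = 0\<close> belong to their closures. The threshold, half the positive number
  \<open>\<Sum>\<^sub>k t\<^sub>k\<^sup>2\<close>, excludes both for the weights.
\<close>
definition simplex_weight :: "nat \<Rightarrow> (nat \<Rightarrow> real) \<Rightarrow> real" where
  "simplex_weight n t = flat_exp 0 (2 * t n - simplex_sum_sq t)"

definition simplex_partition :: "nat \<Rightarrow> (nat \<Rightarrow> real) \<Rightarrow> real" where
  "simplex_partition n t = simplex_weight n t / (\<Sum>k | t k \<noteq> 0. simplex_weight k t)"

lemma simplex_sum_sq_pos:
  assumes "t \<in> pts simplex_diff"
  shows "simplex_sum_sq t > 0"
proof -
  have t: "finite {i. t i \<noteq> 0}" "(\<Sum>i | t i \<noteq> 0. t i) = 1" using assms by (auto simp: pts_simplex_diff)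
  then have "{i. t i \<noteq> 0} \<noteq> {}" by (metis sum.empty zero_neq_one)
  with t(1) show ?thesis unfolding simplex_sum_sq_def by (intro sum_pos) auto
qed

text \<open>
  If \<open>2 t\<^sub>n \<le> Q\<close> for all \<open>n\<close>, where \<open>Q = \<Sum>\<^sub>k t\<^sub>k\<^sup>2\<close>, then \<open>Q \<le> \<Sum>\<^sub>k t\<^sub>k \<cdot> Q / 2 = Q / 2\<close>,
  contradicting \<open>Q > 0\<close>. So some weight is positive at each point of the simplex.
\<close>
lemma simplex_sum_sq_less_max:
  assumes "t \<in> pts simplex_diff"
  obtains n where "simplex_sum_sq t < 2 * t n"
proof -
  have t: "(\<Sum>i | t i \<noteq> 0. t i) = 1" "\<And>i. t i \<ge> 0" using assms by (auto simp: pts_simplex_diff)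
  have False if le: "\<And>n. 2 * t n \<le> simplex_sum_sq t"
  proof -
    have "simplex_sum_sq t \<le> (\<Sum>i | t i \<noteq> 0. t i * (simplex_sum_sq t / 2))"
    proof (subst simplex_sum_sq_def, rule sum_mono)
      show "(t i)\<^sup>2 \<le> t i * (simplex_sum_sq t / 2)" for i
        using mult_left_mono[of "t i" "simplex_sum_sq t / 2" "t i"] le[of i] t(2)[of i]
        by (simp add: power2_eq_square)
    qed
    also have "\<dots> = simplex_sum_sq t / 2" by (simp only: sum_distrib_right[symmetric] t(1))
    finally show False using simplex_sum_sq_pos[OF assms] by simp
  qed
  then show thesis using that by (meson not_less)
qed

lemma simplex_weight_eq_0: "t \<in> pts simplex_diff \<Longrightarrow> t n = 0 \<Longrightarrow> simplex_weight n t = 0"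
  using simplex_sum_sq_pos[of t] by (simp add: simplex_weight_def flat_exp_nonpos)

lemma simplex_weight_nonneg: "simplex_weight n t \<ge> 0"
  by (simp add: simplex_weight_def flat_exp_nonneg)

lemma simplex_weight_sum_pos:
  assumes t: "t \<in> pts simplex_diff"
  shows "(\<Sum>k | t k \<noteq> 0. simplex_weight k t) > 0"
proof -
  obtain n where n: "simplex_sum_sq t < 2 * t n" using simplex_sum_sq_less_max[OF t] .
  show ?thesis
  proof (rule sum_pos2)
    show "finite {k. t k \<noteq> 0}" using t by (simp add: pts_simplex_diff)
    show "n \<in> {k. t k \<noteq> 0}" using n simplex_sum_sq_pos[OF t] by auto
    show "0 < simplex_weight n t" using n by (simp add: simplex_weight_def flat_exp_pos)
  qed (rule simplex_weight_nonneg)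
qed

lemma simplex_partition_nonneg: "simplex_partition n t \<ge> 0"
  unfolding simplex_partition_def by (intro divide_nonneg_nonneg sum_nonneg simplex_weight_nonneg)

lemma simplex_partition_sum:
  assumes t: "t \<in> pts simplex_diff"
  shows "(\<Sum>n | simplex_partition n t \<noteq> 0. simplex_partition n t) = 1"
proof -
  have "(\<Sum>n | simplex_partition n t \<noteq> 0. simplex_partition n t) = (\<Sum>n | t n \<noteq> 0. simplex_partition n t)"
    using t simplex_weight_eq_0[OF t]
    by (intro sum.mono_neutral_left) (auto simp: pts_simplex_diff simplex_partition_def)
  also have "\<dots> = 1"
    using simplex_weight_sum_pos[OF t] by (simp add: simplex_partition_def sum_divide_distrib[symmetric])
  finally show ?thesis .
qed

lemma simplex_partition_posD: "simplex_partition n t > 0 \<Longrightarrow> simplex_sum_sq t < 2 * t n"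
  by (rule ccontr) (simp add: simplex_partition_def simplex_weight_def flat_exp_nonpos)

lemma dsmooth_simplex_coordinate: "dsmooth simplex_diff real_diff (\<lambda>t. t n)"
  by (rule dsmoothI) (auto simp: plot_simplex_diff)

lemma dsmooth_simplex_sum_sq: "dsmooth simplex_diff real_diff simplex_sum_sq"
  by (rule dsmoothI)
    (auto simp: simplex_sum_sq_def power2_eq_square plot_simplex_diff intro!: smooth_fun_sum_over_support smooth_fun_mult)

lemma dsmooth_simplex_weight: "dsmooth simplex_diff real_diff (simplex_weight n)"
proof (rule dsmoothI)
  fix m U p assume p: "plot simplex_diff m U p"
  have 1: "smooth_fun m U (\<lambda>u. p u n)" using p by (simp add: plot_simplex_diff)
  have 2: "smooth_fun m U (\<lambda>u. simplex_sum_sq (p u))" using dsmooth_plot[OF dsmooth_simplex_sum_sq p] by simp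
  have 3: "smooth_fun m U (\<lambda>_. 2)" using p by (simp add: plot_simplex_diff smooth_fun_const)
  show "plot real_diff m U (\<lambda>u. simplex_weight n (p u))"
    unfolding simplex_weight_def real_diff_simps by (intro smooth_fun_flat_exp smooth_fun_diff smooth_fun_mult 1 2 3)
qed simp

lemma dsmooth_simplex_partition: "dsmooth simplex_diff real_diff (simplex_partition n)"
proof (rule dsmoothI)
  fix m U p assume p: "plot simplex_diff m U p"
  then have pts: "p u \<in> pts simplex_diff" if "u \<in> U" for u using that by (simp add: plot_simplex_diff)
  have w: "smooth_fun m U (\<lambda>u. simplex_weight k (p u))" for k
    using dsmooth_plot[OF dsmooth_simplex_weight p] by simp
  show "plot real_diff m U (\<lambda>u. simplex_partition n (p u))"
    unfolding simplex_partition_def real_diff_simps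
    by (intro smooth_fun_divide w smooth_fun_sum_over_support p)
      (use pts simplex_weight_eq_0 simplex_weight_sum_pos in fastforce)+
qed simp

lemma D_supp_simplex_partition:
  assumes X: "diffeological_space X" and b: "dsmooth X simplex_diff b"
  shows "D_supp X (\<lambda>x. simplex_partition n (b x)) \<subseteq> {x \<in> pts X. simplex_sum_sq (b x) \<le> 2 * b x n}"
proof -
  have "dsmooth X real_diff (\<lambda>x. 2 * b x n - simplex_sum_sq (b x))"
  proof (rule dsmoothI)
    fix m U p assume p: "plot X m U p"
    have 1: "smooth_fun m U (\<lambda>u. b (p u) n)"
      using dsmooth_plot[OF b p] by (simp add: plot_simplex_diff)
    have 2: "smooth_fun m U (\<lambda>u. simplex_sum_sq (b (p u)))"
      using dsmooth_plot[OF dsmooth_compose[OF dsmooth_simplex_sum_sq b] p] by simp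
    show "plot real_diff m U (\<lambda>u. 2 * b (p u) n - simplex_sum_sq (b (p u)))"
      using smooth_fun_diff[OF smooth_fun_mult[OF smooth_fun_const[OF smooth_fun_openin[OF 1]] 1] 2] by simp
  qed simp
  from D_supp_subset_nonneg[OF X this, of "\<lambda>x. simplex_partition n (b x)"] show ?thesis
    using simplex_partition_posD by force
qed

text \<open>
  Let \<open>t = b x\<close> have its nonzero coordinates among those up to \<open>N\<close>, and let \<open>W\<close> consist of the points
  whose coordinates beyond \<open>N\<close> have a sum below \<open>Q / 2\<close>, where \<open>Q\<close> is the sum of the squares of all
  coordinates. That sum is \<open>1 - \<Sum>\<^sub>i\<^sub>\<le>\<^sub>N t\<^sub>i\<close>, so \<open>W\<close> is given by a strict inequality between
  smooth functions and is D-open; it contains \<open>x\<close>, where the sum is \<open>0\<close>. On \<open>W\<close> no coordinate beyond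
  \<open>N\<close> reaches \<open>Q / 2\<close>, whereas on the support of the \<open>n\<close>-th function the \<open>n\<close>-th coordinate does.
\<close>
lemma simplex_partition_locally_finite:
  assumes X: "diffeological_space X" and b: "dsmooth X simplex_diff b" and x: "x \<in> pts X"
  obtains W where "D_open X W" "x \<in> W"
    "finite {n. D_supp X (\<lambda>x. simplex_partition n (b x)) \<inter> W \<noteq> {}}"
proof -
  have pts: "b y \<in> pts simplex_diff" if "y \<in> pts X" for y using dsmooth_in_pts[OF b that] .
  have fin: "finite {i. b y i \<noteq> 0}" and sum1: "(\<Sum>i | b y i \<noteq> 0. b y i) = 1" and nonneg: "b y i \<ge> 0"
    if "y \<in> pts X" for y i using pts[OF that] by (auto simp: pts_simplex_diff)
  obtain N where N: "\<And>i. b x i \<noteq> 0 \<Longrightarrow> i \<le> N"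
    using fin[OF x] unfolding finite_nat_set_iff_bounded_le by blast
  let ?g = "\<lambda>y. 2 * (1 - (\<Sum>i\<le>N. b y i)) - simplex_sum_sq (b y)"
  have g: "dsmooth X real_diff ?g"
  proof (rule dsmoothI)
    fix m U p assume p: "plot X m U p"
    have 1: "smooth_fun m U (\<lambda>u. b (p u) i)" for i
      using dsmooth_plot[OF b p] by (simp add: plot_simplex_diff)
    have 2: "smooth_fun m U (\<lambda>u. simplex_sum_sq (b (p u)))"
      using dsmooth_plot[OF dsmooth_compose[OF dsmooth_simplex_sum_sq b] p] by simp
    have U: "openin (Euclidean_space m) U" by (rule smooth_fun_openin[OF 2])
    have "smooth_fun m U (\<lambda>u. ?g (p u))"
      by (intro smooth_fun_diff smooth_fun_mult smooth_fun_sum smooth_fun_const[OF U] U 1 2)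
    then show "plot real_diff m U (\<lambda>u. ?g (p u))" by simp
  qed simp
  let ?W = "{y \<in> pts X. ?g y \<in> {..<0}}"
  show thesis
  proof (rule that)
    show "D_open X ?W" by (rule D_open_preimage_real[OF X g open_lessThan])
    have "(\<Sum>i\<le>N. b x i) = (\<Sum>i | b x i \<noteq> 0. b x i)"
      by (rule sum.mono_neutral_right) (use N in auto)
    then show "x \<in> ?W" using x sum1[OF x] simplex_sum_sq_pos[OF pts[OF x]] by simp
    have "n \<le> N" if y: "y \<in> D_supp X (\<lambda>x. simplex_partition n (b x))" "y \<in> ?W" for n y
    proof (rule ccontr)
      assume n: "\<not> n \<le> N"
      have yX: "y \<in> pts X" using y(2) by simp
      have "(\<Sum>i\<le>N. b y i) + b y n = (\<Sum>i\<in>insert n {..N}. b y i)" using n by simp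
      also have "\<dots> \<le> (\<Sum>i \<in> {i. b y i \<noteq> 0} \<union> insert n {..N}. b y i)"
        by (rule sum_mono2) (use fin[OF yX] nonneg[OF yX] in auto)
      also have "\<dots> = (\<Sum>i | b y i \<noteq> 0. b y i)"
        by (rule sum.mono_neutral_right) (use fin[OF yX] in auto)
      also have "\<dots> = 1" by (rule sum1[OF yX])
      finally have "b y n \<le> 1 - (\<Sum>i\<le>N. b y i)" by simp
      moreover have "simplex_sum_sq (b y) \<le> 2 * b y n" using D_supp_simplex_partition[OF X b] y(1) by blast
      ultimately show False using y(2) by simp
    qed
    then have "{n. D_supp X (\<lambda>x. simplex_partition n (b x)) \<inter> ?W \<noteq> {}} \<subseteq> {..N}" by blast
    then show "finite {n. D_supp X (\<lambda>x. simplex_partition n (b x)) \<inter> ?W \<noteq> {}}"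
      using finite_subset by blast
  qed
qed

section \<open>Numerability from a map to the simplex\<close>

text \<open>
  The partition of unity on the simplex is pulled back along \<open>b\<close>. Since it is indexed by the covering
  sets themselves, those must be distinct for distinct \<open>n\<close>.
\<close>
lemma D_numerable_if_map_to_simplex:
  fixes E :: "'e diffeology" and B :: "'b diffeology"
  assumes E: "orbit_bundle G D E B act \<pi>" and b: "dsmooth B simplex_diff b"
  defines "A \<equiv> \<lambda>n. {x \<in> pts B. b x n \<noteq> 0}"
  assumes inj: "inj A"
    and \<tau>: "\<And>n. dsmooth (sub_diff E {x \<in> pts E. \<pi> x \<in> A n}) D (\<tau> n)"
    and \<tau>_act: "\<And>n x g. x \<in> pts E \<Longrightarrow> \<pi> x \<in> A n \<Longrightarrow> g \<in> carrier G \<Longrightarrow> \<tau> n (act x g) = \<tau> n x \<otimes>\<^bsub>G\<^esub> g"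
  shows "D_numerable_principal_bundle G D E B act \<pi>"
proof -
  have dB: "diffeological_space B" using orbit_bundle_data[OF E] by (simp add: bundle_data_def)
  have pts: "b x \<in> pts simplex_diff" if "x \<in> pts B" for x using dsmooth_in_pts[OF b that] .
  have A_open: "D_open B (A n)" for n
    using D_open_preimage_real[OF dB dsmooth_compose[OF dsmooth_simplex_coordinate b], of "- {0}" n]
    by (simp add: A_def open_Compl)
  have A_cover: "(\<Union>n. A n) = pts B"
  proof -
    have "\<exists>n. b x n \<noteq> 0" if "x \<in> pts B" for x
      using simplex_sum_sq_less_max[OF pts[OF that]] simplex_sum_sq_pos[OF pts[OF that]] by (metis mult_zero_right not_less_iff_gr_or_eq)
    then show ?thesis by (auto simp: A_def)
  qed
  \<comment> \<open>The index of a covering set, recovered from the set.\<close>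
  define ix where "ix = inv_into UNIV A"
  have ix: "ix (A n) = n" for n using inj by (simp add: ix_def)
  define \<mu> where "\<mu> = (\<lambda>S x. simplex_partition (ix S) (b x))"
  have supp: "D_supp B (\<mu> (A n)) \<subseteq> A n" for n
  proof -
    have "b x n \<noteq> 0" if "x \<in> pts B" "simplex_sum_sq (b x) \<le> 2 * b x n" for x
      using simplex_sum_sq_pos[OF pts[OF that(1)]] that(2) by auto
    then have "D_supp B (\<lambda>x. simplex_partition n (b x)) \<subseteq> A n"
      using D_supp_simplex_partition[OF dB b, of n] by (auto simp: A_def)
    then show ?thesis by (simp add: \<mu>_def ix)
  qed
  have "smooth_partition_of_unity B (range A) \<mu>"
    unfolding smooth_partition_of_unity_def
  proof (intro conjI ballI)
    show "dsmooth B real_diff (\<mu> S)" for S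
      unfolding \<mu>_def by (rule dsmooth_compose[OF dsmooth_simplex_partition b])
    show "\<mu> S x \<ge> 0" for S x by (simp add: \<mu>_def simplex_partition_nonneg)
  next
    fix x assume "x \<in> pts B"
    then obtain W where W: "D_open B W" "x \<in> W"
      "finite {n. D_supp B (\<lambda>x. simplex_partition n (b x)) \<inter> W \<noteq> {}}"
      by (rule simplex_partition_locally_finite[OF dB b])
    have "{S \<in> range A. D_supp B (\<mu> S) \<inter> W \<noteq> {}} \<subseteq>
        A ` {n. D_supp B (\<lambda>x. simplex_partition n (b x)) \<inter> W \<noteq> {}}"
      by (auto simp: \<mu>_def ix intro!: imageI)
    then have "finite {S \<in> range A. D_supp B (\<mu> S) \<inter> W \<noteq> {}}"
      using W(3) finite_surj by blast
    with W(1,2) show "\<exists>W. D_open B W \<and> x \<in> W \<and> finite {S \<in> range A. D_supp B (\<mu> S) \<inter> W \<noteq> {}}" by blast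
  next
    fix x assume x: "x \<in> pts B"
    have "{S \<in> range A. \<mu> S x \<noteq> 0} = A ` {n. simplex_partition n (b x) \<noteq> 0}"
      by (auto simp: \<mu>_def ix)
    then have "supp_sum (\<lambda>S. \<mu> S x) (range A) = (\<Sum>n | simplex_partition n (b x) \<noteq> 0. \<mu> (A n) x)"
      by (simp add: supp_sum_def support_on_def sum.reindex inj_on_subset[OF inj])
    then show "supp_sum (\<lambda>S. \<mu> S x) (range A) = 1"
      by (simp add: \<mu>_def ix simplex_partition_sum[OF pts[OF x]])
  qed
  moreover have "principal_bundle G D E B act \<pi>"
  proof (rule orbit_bundle_principal[OF E, where \<U> = "range A" and \<tau> = "\<lambda>S. \<tau> (ix S)"])
    show "\<Union>(range A) = pts B" by (rule A_cover)
  qed (use A_open \<tau> \<tau>_act in \<open>auto simp: ix\<close>)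
  moreover have "trivial_over G D E B act \<pi> (A n)" for n
    using \<tau>_act by (intro orbit_bundle_trivial_over[OF E \<tau>])
  moreover have "subordinate B (range A) \<mu> id" using supp by (auto simp: subordinate_def)
  ultimately show ?thesis
    unfolding D_numerable_principal_bundle_def using A_open A_cover
    by (intro conjI exI[of _ "range A"] exI[of _ id] exI[of _ \<mu>]) auto
qed

section \<open>The bundle \<open>EG \<rightarrow> BG\<close>\<close>

lemma diffeological_space_EG_pre:
  "diffeological_space D \<Longrightarrow> diffeological_space (EG_pre D)"
  unfolding EG_pre_def by (intro diffeological_space_prod diffeological_space_simplex diffeological_space_seq)

text \<open>
  The explicit form of an equivalence class: all members share \<open>t\<close>, and they share \<open>g\<^sub>i\<close> where
  \<open>t\<^sub>i \<noteq> 0\<close>. The coordinates of a point of \<open>EG\<close> can thus be read off from any member.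
\<close>
lemma EG_class:
  assumes "(t, g) \<in> pts (EG_pre D)"
  shows "EG_rel D `` {(t, g)} = {(t, g') | g'. (\<forall>i. g' i \<in> pts D) \<and> (\<forall>i. t i \<noteq> 0 \<longrightarrow> g i = g' i)}"
  using assms by (auto simp: EG_rel_def EG_pre_def fun_eq_iff)

definition EG_bary :: "'g EG_point \<Rightarrow> nat \<Rightarrow> real" where
  "EG_bary c = fst (SOME z. z \<in> c)"

text \<open>
  Independent of the chosen member, hence meaningful, only where the \<open>n\<close>-th barycentric coordinate is
  nonzero.
\<close>
definition EG_coord :: "nat \<Rightarrow> 'g EG_point \<Rightarrow> 'g" where
  "EG_coord n c = snd (SOME z. z \<in> c) n"

lemma EG_representative:
  assumes "(t, g) \<in> pts (EG_pre D)"
  shows "(SOME z. z \<in> EG_rel D `` {(t, g)}) \<in> EG_rel D `` {(t, g)}"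
  by (rule someI[of _ "(t, g)"]) (use assms in \<open>auto simp: EG_class, auto simp: EG_pre_def\<close>)

lemma EG_bary_class: "(t, g) \<in> pts (EG_pre D) \<Longrightarrow> EG_bary (EG_rel D `` {(t, g)}) = t"
  using EG_representative[of t g D] by (auto simp: EG_bary_def EG_class)

lemma EG_coord_class: "(t, g) \<in> pts (EG_pre D) \<Longrightarrow> t n \<noteq> 0 \<Longrightarrow> EG_coord n (EG_rel D `` {(t, g)}) = g n"
  using EG_representative[of t g D] by (auto simp: EG_coord_def EG_class)

text \<open>
  Changing a coordinate \<open>g\<^sub>i\<close> with \<open>t\<^sub>i = 0\<close> does not affect the class of \<open>(t, g \<cdot> h)\<close>, so the union that
  defines the action is taken over copies of one class.
\<close>
lemma EG_act_class:
  assumes D: "diffeological_group G D" and tg: "(t, g) \<in> pts (EG_pre D)" and h: "h \<in> carrier G"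
  shows "EG_act G D (EG_rel D `` {(t, g)}) h = EG_rel D `` {(t, \<lambda>i. g i \<otimes>\<^bsub>G\<^esub> h)}"
    and "(t, \<lambda>i. g i \<otimes>\<^bsub>G\<^esub> h) \<in> pts (EG_pre D)"
proof -
  interpret group G using D by (simp add: diffeological_group_def)
  have ptsD: "pts D = carrier G" using D by (simp add: diffeological_group_def)
  have pre: "(t, \<lambda>i. g' i \<otimes>\<^bsub>G\<^esub> h) \<in> pts (EG_pre D)" if "\<And>i. g' i \<in> pts D" for g'
    using tg that h by (auto simp: EG_pre_def ptsD)
  have g: "g i \<in> pts D" for i using tg by (auto simp: EG_pre_def)
  from pre[OF g] show "(t, \<lambda>i. g i \<otimes>\<^bsub>G\<^esub> h) \<in> pts (EG_pre D)" .
  have "EG_rel D `` {(t, \<lambda>i. g' i \<otimes>\<^bsub>G\<^esub> h)} = EG_rel D `` {(t, \<lambda>i. g i \<otimes>\<^bsub>G\<^esub> h)}"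
    if "\<And>i. g' i \<in> pts D" "\<And>i. t i \<noteq> 0 \<Longrightarrow> g i = g' i" for g'
    using that(2) by (auto simp: EG_class[OF pre[OF that(1)]] EG_class[OF pre[OF g]])
  note indep = this
  have "EG_rel D `` {(fst z, \<lambda>i. snd z i \<otimes>\<^bsub>G\<^esub> h)} = EG_rel D `` {(t, \<lambda>i. g i \<otimes>\<^bsub>G\<^esub> h)}"
    if "z \<in> EG_rel D `` {(t, g)}" for z
  proof -
    have "fst z = t" "\<And>i. snd z i \<in> pts D" "\<And>i. t i \<noteq> 0 \<Longrightarrow> g i = snd z i"
      using that by (auto simp: EG_class[OF tg])
    then show ?thesis using indep[of "snd z"] by simp
  qed
  moreover have "EG_rel D `` {(t, g)} \<noteq> {}" using g by (auto simp: EG_class[OF tg])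
  ultimately show "EG_act G D (EG_rel D `` {(t, g)}) h = EG_rel D `` {(t, \<lambda>i. g i \<otimes>\<^bsub>G\<^esub> h)}"
    unfolding EG_act_def split_beta by (intro SUP_eq_const)
qed

lemma EG_pointE:
  assumes "c \<in> pts (EG D)"
  obtains t g where "(t, g) \<in> pts (EG_pre D)" "c = EG_rel D `` {(t, g)}"
  using assms by (auto simp: EG_def elim!: quotientE)

lemma diffeological_space_EG: "diffeological_space D \<Longrightarrow> diffeological_space (EG D)"
  unfolding EG_def by (intro diffeological_space_quot diffeological_space_EG_pre)

lemma EG_smooth_right_action:
  assumes D: "diffeological_group G D"
  shows "smooth_right_action G D (EG D) (EG_act G D)"
proof -
  interpret group G using D by (simp add: diffeological_group_def)
  have ptsD: "pts D = carrier G" and dD: "diffeological_space D"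
    using D by (simp_all add: diffeological_group_def)
  note dpre = diffeological_space_EG_pre[OF dD] and dEG = diffeological_space_EG[OF dD]
  have class_pts: "EG_rel D `` {z} \<in> pts (EG D)" if "z \<in> pts (EG_pre D)" for z
    using that by (auto simp: EG_def intro: quotientI)
  have gG: "g i \<in> carrier G" if "(t, g) \<in> pts (EG_pre D)" for t g i
    using that by (simp add: EG_pre_def ptsD)
  show ?thesis
    unfolding smooth_right_action_def
  proof (intro conjI ballI)
    show "dsmooth (prod_diff (EG D) D) (EG D) (\<lambda>(x, g). EG_act G D x g)"
    proof (rule dsmoothI)
      fix y assume "y \<in> pts (prod_diff (EG D) D)"
      then obtain c h where y: "y = (c, h)" "c \<in> pts (EG D)" "h \<in> carrier G" using ptsD by auto
      then obtain t g where "(t, g) \<in> pts (EG_pre D)" "c = EG_rel D `` {(t, g)}" by (auto elim: EG_pointE)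
      with y show "(case y of (x, g) \<Rightarrow> EG_act G D x g) \<in> pts (EG D)"
        using EG_act_class[OF D, of t g h] class_pts by simp
    next
      fix n U p assume "plot (prod_diff (EG D) D) n U p"
      then have p1: "plot (EG D) n U (\<lambda>u. fst (p u))" and p2: "plot D n U (\<lambda>u. snd (p u))" by auto
      show "plot (EG D) n U (\<lambda>u. case p u of (x, g) \<Rightarrow> EG_act G D x g)"
      proof (rule plot_local[OF dEG plot_openin[OF dD p2]])
        fix u assume u: "u \<in> U"
        obtain V q where V: "openin (Euclidean_space n) V" "u \<in> V" "V \<subseteq> U"
          and q: "plot (EG_pre D) n V q" "\<forall>v\<in>V. fst (p v) = EG_rel D `` {q v}"
          by (rule plot_quot_diffE[OF p1[unfolded EG_def] u])
        have p2V: "plot D n V (\<lambda>u. snd (p u))" by (rule plot_subset[OF dD p2 V(1,3)])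
        let ?r = "\<lambda>v. (fst (q v), \<lambda>i. snd (q v) i \<otimes>\<^bsub>G\<^esub> snd (p v))"
        have "plot (EG_pre D) n V ?r"
          using q(1) by (auto simp: EG_pre_def intro: plot_group_mult[OF D _ p2V])
        then have "plot (EG D) n V (\<lambda>v. EG_rel D `` {?r v})"
          unfolding EG_def by (rule dsmooth_plot[OF dsmooth_quotient_map[OF dpre]])
        moreover have "(case p v of (x, g) \<Rightarrow> EG_act G D x g) = EG_rel D `` {?r v}" if v: "v \<in> V" for v
          using EG_act_class(1)[OF D, of "fst (q v)" "snd (q v)" "snd (p v)"] q(2)[rule_format, OF v]
            plot_in_pts[OF dpre q(1) v] plot_in_pts[OF dD p2V v] ptsD
          by (simp add: split_beta)
        ultimately have "plot (EG D) n V (\<lambda>u. case p u of (x, g) \<Rightarrow> EG_act G D x g)"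
          by (rule plot_cong[OF dEG])
        with V show "\<exists>V. openin (Euclidean_space n) V \<and> u \<in> V \<and> V \<subseteq> U \<and>
            plot (EG D) n V (\<lambda>u. case p u of (x, g) \<Rightarrow> EG_act G D x g)" by blast
      qed
    qed
  next
    fix c assume "c \<in> pts (EG D)"
    then obtain t g where tg: "(t, g) \<in> pts (EG_pre D)" and c: "c = EG_rel D `` {(t, g)}" by (rule EG_pointE)
    show "EG_act G D c \<one>\<^bsub>G\<^esub> = c"
      using gG[OF tg] by (simp add: c EG_act_class[OF D tg])
    fix h k assume hk: "h \<in> carrier G" "k \<in> carrier G"
    show "EG_act G D (EG_act G D c h) k = EG_act G D c (h \<otimes>\<^bsub>G\<^esub> k)"
      using hk gG[OF tg] by (simp add: c EG_act_class[OF D tg] EG_act_class(1)[OF D EG_act_class(2)[OF D tg]] m_assoc)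
  qed
qed

lemma EG_bary_act:
  assumes "diffeological_group G D" "c \<in> pts (EG D)" "h \<in> carrier G"
  shows "EG_bary (EG_act G D c h) = EG_bary c"
  using assms(2) by (rule EG_pointE) (simp add: EG_act_class[OF assms(1) _ assms(3)] EG_bary_class)

lemma EG_coord_act:
  assumes "diffeological_group G D" "c \<in> pts (EG D)" "h \<in> carrier G" "EG_bary c n \<noteq> 0"
  shows "EG_coord n (EG_act G D c h) = EG_coord n c \<otimes>\<^bsub>G\<^esub> h"
  using assms(2) by (rule EG_pointE)
    (use assms(4) in \<open>simp add: EG_act_class[OF assms(1) _ assms(3)] EG_bary_class EG_coord_class\<close>)

lemma dsmooth_EG_bary: "diffeological_space D \<Longrightarrow> dsmooth (EG D) simplex_diff EG_bary"
  unfolding EG_def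
  by (rule dsmooth_quot_diffI[where g = fst])
    (auto simp: diffeological_space_simplex diffeological_space_EG_pre EG_bary_class, auto simp: EG_pre_def intro: dsmoothI)

lemma dsmooth_EG_coord:
  assumes D: "diffeological_space D"
  shows "dsmooth (sub_diff (EG D) {c \<in> pts (EG D). EG_bary c n \<noteq> 0}) D (EG_coord n)"
proof -
  let ?A = "{c \<in> pts (EG D). EG_bary c n \<noteq> 0}"
  have "EG_coord n (EG_rel D `` {z}) = snd z n" if "z \<in> pts (EG_pre D)" "EG_rel D `` {z} \<in> ?A" for z
    using that by (cases z) (simp add: EG_bary_class EG_coord_class)
  moreover have "dsmooth (sub_diff (EG_pre D) {z. EG_rel D `` {z} \<in> ?A}) D (\<lambda>z. snd z n)"
    by (rule dsmoothI) (auto simp: EG_pre_def)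
  ultimately have "dsmooth (sub_diff (quot_diff (EG_pre D) (EG_rel D)) ?A) D (EG_coord n)"
    by (intro dsmooth_sub_quot_diffI[OF D _ diffeological_space_EG_pre[OF D]])
  then show ?thesis by (simp add: EG_def[symmetric])
qed

theorem theorem5p3:
  fixes G :: "('g, 'm) monoid_scheme" and D :: "'g diffeology"
  assumes "diffeological_group G D"
  shows "D_numerable_principal_bundle G D (EG D) (BG G D) (EG_act G D) (EG_proj G D)"
proof -
  note D = assms
  interpret group G using D by (simp add: diffeological_group_def)
  have ptsD: "pts D = carrier G" and dD: "diffeological_space D"
    using D by (simp_all add: diffeological_group_def)
  note dEG = diffeological_space_EG[OF dD] and act = EG_smooth_right_action[OF D]
  let ?R = "orbit_rel G (EG D) (EG_act G D)"
  have BG: "orbit_bundle G D (EG D) (BG G D) (EG_act G D) (EG_proj G D)"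
    using orbit_bundle_orbit_space[OF D dEG act]
    by (simp add: BG_def EG_proj_def[abs_def])
  define b :: "'g EG_point set \<Rightarrow> nat \<Rightarrow> real" where "b = (\<lambda>x. EG_bary (SOME c. c \<in> x))"
  have b_proj: "b (EG_proj G D c) = EG_bary c" if c: "c \<in> pts (EG D)" for c
  proof -
    have "EG_act G D c \<one>\<^bsub>G\<^esub> = c" using c act by (simp add: smooth_right_action_def)
    then have "c \<in> EG_proj G D c"
      using c by (auto simp: EG_proj_def orbit_rel_def intro!: bexI[of _ "\<one>\<^bsub>G\<^esub>"])
    then have "(SOME d. d \<in> EG_proj G D c) \<in> EG_proj G D c" by (rule someI)
    then obtain h where "h \<in> carrier G" "(SOME d. d \<in> EG_proj G D c) = EG_act G D c h"
      by (auto simp: EG_proj_def orbit_rel_def)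
    then show ?thesis by (simp add: b_def EG_bary_act[OF D c])
  qed
  have b: "dsmooth (BG G D) simplex_diff b"
    unfolding BG_def
    by (rule dsmooth_quot_diffI[where g = EG_bary])
      (use b_proj in \<open>simp_all add: EG_proj_def diffeological_space_simplex dEG dsmooth_EG_bary dD\<close>)
  have proj_pts: "EG_proj G D c \<in> pts (BG G D)" if "c \<in> pts (EG D)" for c
    using that by (simp add: BG_def EG_proj_def quotientI)
  have preimage: "{c \<in> pts (EG D). EG_proj G D c \<in> {x \<in> pts (BG G D). b x n \<noteq> 0}}
      = {c \<in> pts (EG D). EG_bary c n \<noteq> 0}" for n
    using b_proj proj_pts by auto
  show ?thesis
  proof (rule D_numerable_if_map_to_simplex[OF BG b, where \<tau> = EG_coord])
    show "inj (\<lambda>n. {x \<in> pts (BG G D). b x n \<noteq> 0})"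
    proof (rule injI)
      fix m n
      assume eq: "{x \<in> pts (BG G D). b x m \<noteq> 0} = {x \<in> pts (BG G D). b x n \<noteq> 0}"
      \<comment> \<open>The \<open>m\<close>-th vertex of the simplex lies in no covering set but the \<open>m\<close>-th one.\<close>
      define e :: "nat \<Rightarrow> real" where "e = (\<lambda>i. if i = m then 1 else 0)"
      have "{i. e i \<noteq> 0} = {m}" by (auto simp: e_def)
      then have "(e, \<lambda>_. \<one>\<^bsub>G\<^esub>) \<in> pts (EG_pre D)"
        by (auto simp: EG_pre_def pts_simplex_diff ptsD e_def)
      then have c: "EG_rel D `` {(e, \<lambda>_. \<one>\<^bsub>G\<^esub>)} \<in> pts (EG D)"
        and e: "EG_bary (EG_rel D `` {(e, \<lambda>_. \<one>\<^bsub>G\<^esub>)}) = e"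
        by (auto simp: EG_def EG_bary_class intro: quotientI)
      let ?x = "EG_proj G D (EG_rel D `` {(e, \<lambda>_. \<one>\<^bsub>G\<^esub>)})"
      have "b ?x = e" using b_proj[OF c] e by simp
      moreover have "b ?x m \<noteq> 0 \<longleftrightarrow> b ?x n \<noteq> 0"
        using arg_cong[OF eq, of "\<lambda>S. ?x \<in> S"] proj_pts[OF c] by simp
      ultimately show "m = n" by (simp add: e_def split: if_splits)
    qed
    show "dsmooth (sub_diff (EG D) {c \<in> pts (EG D). EG_proj G D c \<in> {x \<in> pts (BG G D). b x n \<noteq> 0}}) D (EG_coord n)" for n
      unfolding preimage by (rule dsmooth_EG_coord[OF dD])
    show "EG_coord n (EG_act G D c g) = EG_coord n c \<otimes>\<^bsub>G\<^esub> g"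
      if "c \<in> pts (EG D)" "EG_proj G D c \<in> {x \<in> pts (BG G D). b x n \<noteq> 0}" "g \<in> carrier G" for n c g
      using that b_proj by (intro EG_coord_act[OF D]) auto
  qed
qed

end
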